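(* Let $X$ be a real random variable with density $f_0$ (with respect to Lebesgue measure), MGF $M_0$ and CGF $K_0=\log M_0$ with convergence strip $(-\alpha,\beta)$, $0<\alpha,\beta\le\infty$. Assume: (A1) $|K_0'(\theta)|\to\infty$ as $\theta\downarrow-\alpha$ and as $\theta\uparrow\beta$; (A2) at the finite truncation points, the density $f_0$ has one-sided limits from inside the truncation interval (the left limit at the right endpoint of the interval, the right limit at the left endpoint; the intervals are $(-\infty,y)$ in (i), $(y,\infty)$ in (ii), and $(a,b)$ in (iii) and (iv)). Let $y\in\mathbb{R}$, let $-\infty<a<b<\infty$ with $P(a<X<b)>0$, and let $\widehat\Xi_j$, $\widetilde{\mathcal{M}}_j$, $\widetilde{\mathcal{K}}_j$, $\widetilde{\mathcal{M}}_{j,(a,b)}$, $\widetilde{\mathcal{K}}_{j,(a,b)}$ ($j=1,2$) and $\hat f_0$ be as defined in the context. Then: (i) As $\theta\to\infty$, $$\widetilde{\mathcal{M}}_1(\theta)\sim\theta^{-1}e^{\theta y}\hat f_0(y-)/\widehat\Xi_1(0,y),\qquad \widetilde{\mathcal{K}}_1'(\theta)=y-\theta^{-1}+o(\theta^{-1}),\qquad \widetilde{\mathcal{K}}_1''(\theta)\sim\theta^{-2}.$$ (ii) As $\theta\to-\infty$, $$\widetilde{\mathcal{M}}_2(\theta)\sim|\theta|^{-1}e^{\theta y}\hat f_0(y+)/\widehat\Xi_2(0,y),\qquad \widetilde{\mathcal{K}}_2'(\theta)=y-\theta^{-1}+o(\theta^{-1}),\qquad \widetilde{\mathcal{K}}_2''(\theta)\sim\theta^{-2}.$$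 (iii) As $\theta\to\infty$, $$\widetilde{\mathcal{M}}_{1,(a,b)}(\theta)\sim\theta^{-1}e^{\theta b}\hat f_0(b-)/\{\widehat\Xi_1(0,b)-\widehat\Xi_1(0,a)\},$$ $$\widetilde{\mathcal{K}}'_{1,(a,b)}(\theta)=b-\theta^{-1}+o(\theta^{-1}),\qquad \widetilde{\mathcal{K}}''_{1,(a,b)}(\theta)\sim\theta^{-2}.$$ (iv) As $\theta\to-\infty$, $$\widetilde{\mathcal{M}}_{2,(a,b)}(\theta)\sim|\theta|^{-1}e^{\theta a}\hat f_0(a+)/\{\widehat\Xi_2(0,a)-\widehat\Xi_2(0,b)\},$$ $$\widetilde{\mathcal{K}}'_{2,(a,b)}(\theta)=a-\theta^{-1}+o(\theta^{-1}),\qquad \widetilde{\mathcal{K}}''_{2,(a,b)}(\theta)\sim\theta^{-2}.$$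
   Context: "Convergence strip $(-\alpha,\beta)$" means that $M_0(\theta)=E[e^{\theta X}]$ is finite on $(-\alpha,\beta)$, this being its (open) interval of convergence. For real $y$, $t_y\in(-\alpha,\beta)$ is the unique solution $t$ of $K_0'(t)=y$, and the saddlepoint density approximation to $f_0$ is $$\hat f_0(y)=\{2\pi K_0''(t_y)\}^{-1/2}\exp\{K_0(t_y)-t_y y\};$$ $\hat f_0(y-)$ and $\hat f_0(y+)$ denote its left and right limits at $y$. For real $y$, and for $\theta>-\alpha$ if $j=1$, $\theta<\beta$ if $j=2$, let $s_{j,\theta}$ (depending also on $y$) be the unique solution $s\in(-\alpha,\beta)$ of $$K_0'(s)+\{\theta-s\}^{-1}=y$$ satisfying $s_{1,\theta}<\theta$ when $j=1$ and $s_{2,\theta}>\theta$ when $j=2$. Define $$\widehat\Xi_j(\theta,y)=[2\pi\{1+(\theta-s_{j,\theta})^2K_0''(s_{j,\theta})\}]^{-1/2}\exp\{K_0(s_{j,\theta})-(s_{j,\theta}-\theta)y\},\qquad j=1,2.$$ These are approximations to $\int_{-\infty}^y e^{\theta x}f_0(x)\,dx$ ($j=1$) and $\int_y^\infty e^{\theta x}f_0(x)\,dx$ ($j=2$). Set $$\widetilde{\mathcal{M}}_j(\theta)=\widehat\Xi_j(\theta,y)/\widehat\Xi_j(0,y),\qquad \widetilde{\mathcal{K}}_j(\theta)=\log\widetilde{\mathcal{M}}_j(\theta),\qquad j=1,2,$$ and, for $-\infty<a<b<\infty$, $$\widetilde{\mathcal{M}}_{1,(a,b)}(\theta)=\frac{\widehat\Xi_1(\theta,b)-\widehat\Xi_1(\theta,a)}{\widehat\Xi_1(0,b)-\widehat\Xi_1(0,a)}\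 (\theta>-\alpha),\qquad \widetilde{\mathcal{M}}_{2,(a,b)}(\theta)=\frac{\widehat\Xi_2(\theta,a)-\widehat\Xi_2(\theta,b)}{\widehat\Xi_2(0,a)-\widehat\Xi_2(0,b)}\ (\theta<\beta),$$ $\widetilde{\mathcal{K}}_{j,(a,b)}(\theta)=\log\widetilde{\mathcal{M}}_{j,(a,b)}(\theta)$, where it is implicit that the denominators are positive. Primes denote derivatives with respect to $\theta$, and $g\sim h$ means $g/h\to1$. *)

theory Defs
  imports "HOL-Probability.Probability" "HOL-Library.Landau_Symbols"
begin

definition mgf :: "'a measure \<Rightarrow> ('a \<Rightarrow> real) \<Rightarrow> real \<Rightarrow> real" where
  "mgf M X \<theta> = (LINT \<omega>|M. exp (\<theta> * X \<omega>))"

definition cgf :: "'a measure \<Rightarrow> ('a \<Rightarrow> real) \<Rightarrow> real \<Rightarrow> real" where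
  "cgf M X \<theta> = ln (mgf M X \<theta>)"

text \<open>The Lebesgue integral is \<open>0\<close> for non-integrable functions, so finiteness of the moment
  generating function is expressed by integrability.  Only the open interval of convergence is
  fixed; the function may or may not be finite at finite endpoints.\<close>

definition convergence_strip :: "'a measure \<Rightarrow> ('a \<Rightarrow> real) \<Rightarrow> ereal \<Rightarrow> ereal \<Rightarrow> bool" where
  "convergence_strip M X \<alpha> \<beta> \<longleftrightarrow>
     interior {\<theta>. integrable M (\<lambda>\<omega>. exp (\<theta> * X \<omega>))} = einterval (-\<alpha>) \<beta>"

text \<open>In the following, \<open>K\<close> is a cumulant generating function and \<open>S\<close> its open convergence strip.\<close>

definition saddlepoint :: "(real \<Rightarrow> real) \<Rightarrow> real set \<Rightarrow> real \<Rightarrow> real" where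
  "saddlepoint K S y = (THE t. t \<in> S \<and> deriv K t = y)"

definition saddlepoint_density :: "(real \<Rightarrow> real) \<Rightarrow> real set \<Rightarrow> real \<Rightarrow> real" where
  "saddlepoint_density K S y =
     (let t = saddlepoint K S y
      in (2 * pi * deriv (deriv K) t) powr (-1/2) * exp (K t - t * y))"

definition s1 :: "(real \<Rightarrow> real) \<Rightarrow> real set \<Rightarrow> real \<Rightarrow> real \<Rightarrow> real" where
  "s1 K S \<theta> y = (THE s. s \<in> S \<and> s < \<theta> \<and> deriv K s + 1 / (\<theta> - s) = y)"

definition s2 :: "(real \<Rightarrow> real) \<Rightarrow> real set \<Rightarrow> real \<Rightarrow> real \<Rightarrow> real" where
  "s2 K S \<theta> y = (THE s. s \<in> S \<and> s > \<theta> \<and> deriv K s + 1 / (\<theta> - s) = y)"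

definition Xi_at :: "(real \<Rightarrow> real) \<Rightarrow> real \<Rightarrow> real \<Rightarrow> real \<Rightarrow> real" where
  "Xi_at K s \<theta> y =
     (2 * pi * (1 + (\<theta> - s)\<^sup>2 * deriv (deriv K) s)) powr (-1/2) * exp (K s - (s - \<theta>) * y)"

definition Xi1 :: "(real \<Rightarrow> real) \<Rightarrow> real set \<Rightarrow> real \<Rightarrow> real \<Rightarrow> real" where
  "Xi1 K S \<theta> y = Xi_at K (s1 K S \<theta> y) \<theta> y"

definition Xi2 :: "(real \<Rightarrow> real) \<Rightarrow> real set \<Rightarrow> real \<Rightarrow> real \<Rightarrow> real" where
  "Xi2 K S \<theta> y = Xi_at K (s2 K S \<theta> y) \<theta> y"

definition Mt1 :: "(real \<Rightarrow> real) \<Rightarrow> real set \<Rightarrow> real \<Rightarrow> real \<Rightarrow> real" where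
  "Mt1 K S y \<theta> = Xi1 K S \<theta> y / Xi1 K S 0 y"

definition Mt2 :: "(real \<Rightarrow> real) \<Rightarrow> real set \<Rightarrow> real \<Rightarrow> real \<Rightarrow> real" where
  "Mt2 K S y \<theta> = Xi2 K S \<theta> y / Xi2 K S 0 y"

definition Kt1 :: "(real \<Rightarrow> real) \<Rightarrow> real set \<Rightarrow> real \<Rightarrow> real \<Rightarrow> real" where
  "Kt1 K S y \<theta> = ln (Mt1 K S y \<theta>)"

definition Kt2 :: "(real \<Rightarrow> real) \<Rightarrow> real set \<Rightarrow> real \<Rightarrow> real \<Rightarrow> real" where
  "Kt2 K S y \<theta> = ln (Mt2 K S y \<theta>)"

definition Mt1_ab :: "(real \<Rightarrow> real) \<Rightarrow> real set \<Rightarrow> real \<Rightarrow> real \<Rightarrow> real \<Rightarrow> real" where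
  "Mt1_ab K S a b \<theta> = (Xi1 K S \<theta> b - Xi1 K S \<theta> a) / (Xi1 K S 0 b - Xi1 K S 0 a)"

definition Mt2_ab :: "(real \<Rightarrow> real) \<Rightarrow> real set \<Rightarrow> real \<Rightarrow> real \<Rightarrow> real \<Rightarrow> real" where
  "Mt2_ab K S a b \<theta> = (Xi2 K S \<theta> a - Xi2 K S \<theta> b) / (Xi2 K S 0 a - Xi2 K S 0 b)"

definition Kt1_ab :: "(real \<Rightarrow> real) \<Rightarrow> real set \<Rightarrow> real \<Rightarrow> real \<Rightarrow> real \<Rightarrow> real" where
  "Kt1_ab K S a b \<theta> = ln (Mt1_ab K S a b \<theta>)"

definition Kt2_ab :: "(real \<Rightarrow> real) \<Rightarrow> real set \<Rightarrow> real \<Rightarrow> real \<Rightarrow> real \<Rightarrow> real" where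
  "Kt2_ab K S a b \<theta> = ln (Mt2_ab K S a b \<theta>)"

text \<open>\<open>deriv\<close> is unspecified where no derivative exists; this predicate asserts that the first two
  derivatives genuinely exist near the limit described by the filter.\<close>

definition eventually_twice_differentiable :: "(real \<Rightarrow> real) \<Rightarrow> real filter \<Rightarrow> bool" where
  "eventually_twice_differentiable f F \<longleftrightarrow>
     (\<forall>\<^sub>F \<theta> in F. f differentiable (at \<theta>) \<and> deriv f differentiable (at \<theta>))"

end

(* Steepness makes K' a bijection from the strip onto the reals, and K'' > 0 because X has a density.
   With s = s1 and u = theta - s, the function s1(theta) is smooth by the inverse function theorem,
   with s' = 1/Q for Q = 1 + u^2 K''(s), and it increases to the saddlepoint t of y. Hence
   u ~ theta, Q ~ theta^2 K''(t), and
     (log Xi_1)' = y - 1/(u Q) - (1 - 1/Q)^2/u - u^2 K^(3)(s)/(2 Q^2),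
   where only the term (1 - 1/Q)^2/u contributes to the orders 1/theta of the first and 1/theta^2
   of the second derivative. On (a,b) the term Xi_1(theta,a) is smaller than Xi_1(theta,b) by a
   factor of order exp(-(b - a) theta), so it is negligible even after two differentiations. The
   statements for j = 2 follow from those for j = 1 by passing from X to -X. *)

theory Submission
  imports Defs
begin

section \<open>Smoothness of the cumulant generating function\<close>

text \<open>Asymptotic relations cannot be differentiated, so the claims about the first two
  derivatives rest on exact formulas for them. The prefactor of Xi_1 contains the second derivative
  of K, hence two differentiations of log Xi_1 reach the fourth, and four derivatives of K are
  carried along as explicit functions, since the value of \<open>deriv\<close> alone says nothing
  about differentiability. The strip may be bounded while theta tends to infinity, so theta itself
  may leave it; only s1(theta) is guaranteed to stay inside. Everything is therefore expressed
  through K and its derivatives at s1(theta), which converge by continuity at the saddlepoint t.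
  What remains is to track powers of theta: each ingredient is multiplied by the power that gives it
  a finite limit. The saddlepoint density depends on K alone and is continuous, so its one-sided
  limits at a truncation point are its value there, even where the density of X jumps.\<close>

lemma exp_minus_one_minus_bound:
  fixes z :: real
  shows "\<bar>exp z - 1 - z\<bar> \<le> z\<^sup>2 * exp \<bar>z\<bar>"
proof -
  obtain t where t: "\<bar>t\<bar> \<le> \<bar>z\<bar>" "exp z = (\<Sum>m<2. z ^ m / fact m) + exp t / fact 2 * z ^ 2"
    using Maclaurin_exp_le by blast
  then have "exp z - 1 - z = exp t / 2 * z\<^sup>2"
    by (simp add: numeral_2_eq_2)
  moreover have "exp t \<le> exp \<bar>z\<bar>"
    using t(1) by auto
  then have "exp t / 2 * z\<^sup>2 \<le> exp \<bar>z\<bar> * z\<^sup>2"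
    by (intro mult_right_mono) (use exp_gt_zero[of t] in linarith, simp)
  ultimately show ?thesis
    by (simp only: abs_mult) (simp add: mult.commute)
qed

text \<open>A single term of the exponential series with nonnegative terms is at most its
  sum.\<close>

lemma power_le_fact_exp:
  fixes z :: real
  assumes "0 \<le> z"
  shows "z ^ n \<le> fact n * exp z"
proof -
  have "z ^ n / fact n = (\<Sum>m\<in>{n}. z ^ m /\<^sub>R fact m)"
    by (simp add: divide_inverse)
  also have "\<dots> \<le> (\<Sum>m. z ^ m /\<^sub>R fact m)"
    using assms summable_exp_generic[of z] by (intro sum_le_suminf) auto
  finally show ?thesis
    by (simp add: exp_def pos_divide_le_eq mult.commute)
qed

text \<open>One \<open>exp (\<delta> * \<bar>x\<bar>)\<close> absorbs the power of x, and the
  resulting exponential in |x| is one of the two on the right, according to the sign of x. The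
  surplus \<open>\<delta> * \<bar>x\<bar>\<close> on the left is room for a perturbation of the
  tilt.\<close>

lemma abs_power_exp_le:
  fixes x \<theta> \<delta> :: real
  assumes "0 < \<delta>"
  shows "\<bar>x\<bar> ^ n * exp (\<theta> * x + \<delta> * \<bar>x\<bar>)
    \<le> fact n / \<delta> ^ n * (exp ((\<theta> - 2 * \<delta>) * x) + exp ((\<theta> + 2 * \<delta>) * x))"
proof -
  have "(\<delta> * \<bar>x\<bar>) ^ n \<le> fact n * exp (\<delta> * \<bar>x\<bar>)"
    using assms by (intro power_le_fact_exp) auto
  then have "\<bar>x\<bar> ^ n \<le> fact n / \<delta> ^ n * exp (\<delta> * \<bar>x\<bar>)"
    using assms by (simp add: power_mult_distrib field_simps)
  then have "\<bar>x\<bar> ^ n * exp (\<theta> * x + \<delta> * \<bar>x\<bar>)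
      \<le> fact n / \<delta> ^ n * exp (\<delta> * \<bar>x\<bar>) * exp (\<theta> * x + \<delta> * \<bar>x\<bar>)"
    by (intro mult_right_mono) auto
  also have "\<dots> = fact n / \<delta> ^ n * exp (\<theta> * x + 2 * \<delta> * \<bar>x\<bar>)"
    by (simp add: exp_add[symmetric] algebra_simps)
  also have "\<dots> \<le> fact n / \<delta> ^ n * (exp ((\<theta> - 2 * \<delta>) * x) + exp ((\<theta> + 2 * \<delta>) * x))"
  proof (rule mult_left_mono)
    show "exp (\<theta> * x + 2 * \<delta> * \<bar>x\<bar>) \<le> exp ((\<theta> - 2 * \<delta>) * x) + exp ((\<theta> + 2 * \<delta>) * x)"
      by (cases "0 \<le> x") (auto simp: algebra_simps)
  qed (use assms in auto)
  finally show ?thesis .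
qed

text \<open>The unnormalised n-th moment under exponential tilting, which on the strip is the n-th
  derivative of the moment generating function.\<close>

definition tilted_moment :: "'a measure \<Rightarrow> ('a \<Rightarrow> real) \<Rightarrow> nat \<Rightarrow> real \<Rightarrow> real" where
  "tilted_moment M X n \<theta> = (LINT \<omega>|M. X \<omega> ^ n * exp (\<theta> * X \<omega>))"

context
  fixes M :: "'a measure" and X :: "'a \<Rightarrow> real" and S :: "real set"
  assumes X [measurable]: "X \<in> borel_measurable M"
    and open_S: "open S"
    and exp_integrable: "\<And>\<theta>. \<theta> \<in> S \<Longrightarrow> integrable M (\<lambda>\<omega>. exp (\<theta> * X \<omega>))"
begin

text \<open>One margin serves all n at once. The factor with |X| is what later dominates difference
  quotients in the tilt.\<close>

lemma moment_neighbourhood: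
  assumes "\<theta> \<in> S"
  obtains \<delta> where "0 < \<delta>" "\<And>n. integrable M (\<lambda>\<omega>. \<bar>X \<omega>\<bar> ^ n * exp (\<theta> * X \<omega> + \<delta> * \<bar>X \<omega>\<bar>))"
proof -
  obtain e where e: "0 < e" "cball \<theta> e \<subseteq> S"
    using open_S assms open_contains_cball by blast
  \<comment> \<open>The bound uses the tilts at distance \<open>2 * \<delta>\<close>; halving e
    keeps them in the closed ball.\<close>
  define \<delta> where "\<delta> = e / 2"
  have \<delta>: "0 < \<delta>" "\<theta> - 2 * \<delta> \<in> S" "\<theta> + 2 * \<delta> \<in> S"
    using e by (auto simp: \<delta>_def dist_real_def subset_iff)
  have "integrable M (\<lambda>\<omega>. \<bar>X \<omega>\<bar> ^ n * exp (\<theta> * X \<omega> + \<delta> * \<bar>X \<omega>\<bar>))" for n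
  proof (rule Bochner_Integration.integrable_bound)
    show "integrable M (\<lambda>\<omega>. fact n / \<delta> ^ n *
        (exp ((\<theta> - 2 * \<delta>) * X \<omega>) + exp ((\<theta> + 2 * \<delta>) * X \<omega>)))"
      using \<delta> exp_integrable by simp
    show "AE \<omega> in M. norm (\<bar>X \<omega>\<bar> ^ n * exp (\<theta> * X \<omega> + \<delta> * \<bar>X \<omega>\<bar>)) \<le>
      norm (fact n / \<delta> ^ n * (exp ((\<theta> - 2 * \<delta>) * X \<omega>) + exp ((\<theta> + 2 * \<delta>) * X \<omega>)))"
      using abs_power_exp_le[OF \<delta>(1)]
      by (intro AE_I2 order_trans[OF _ abs_ge_self[folded real_norm_def]]) (use \<delta>(1) in \<open>auto simp: abs_mult\<close>)
  qed simp
  with \<delta>(1) show ?thesis ..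
qed

lemma tilted_moment_integrable:
  assumes "\<theta> \<in> S"
  shows "integrable M (\<lambda>\<omega>. X \<omega> ^ n * exp (\<theta> * X \<omega>))"
proof -
  obtain \<delta> where \<delta>: "0 < \<delta>"
      "\<And>n. integrable M (\<lambda>\<omega>. \<bar>X \<omega>\<bar> ^ n * exp (\<theta> * X \<omega> + \<delta> * \<bar>X \<omega>\<bar>))"
    using moment_neighbourhood[OF assms] by blast
  show ?thesis
    by (rule Bochner_Integration.integrable_bound[OF \<delta>(2)[of n]])
      (use \<delta>(1) in \<open>auto simp: abs_mult power_abs intro!: mult_left_mono\<close>)
qed

text \<open>Differentiation under the integral sign. The second-order Taylor remainder of the
  exponential gives an error of at most C |h| for the difference quotient, so no limit has to be
  interchanged with the integral.\<close>

lemma tilted_moment_has_derivative: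
  assumes \<theta>: "\<theta> \<in> S"
  shows "(tilted_moment M X n has_real_derivative tilted_moment M X (Suc n) \<theta>) (at \<theta>)"
proof -
  obtain \<delta> where \<delta>: "0 < \<delta>"
      "\<And>n. integrable M (\<lambda>\<omega>. \<bar>X \<omega>\<bar> ^ n * exp (\<theta> * X \<omega> + \<delta> * \<bar>X \<omega>\<bar>))"
    using moment_neighbourhood[OF \<theta>] by blast
  define C where "C = (LINT \<omega>|M. \<bar>X \<omega>\<bar> ^ (n + 2) * exp (\<theta> * X \<omega> + \<delta> * \<bar>X \<omega>\<bar>))"
  obtain e where e: "0 < e" "ball \<theta> e \<subseteq> S"
    using open_S \<theta> open_contains_ball by blast
  let ?m = "tilted_moment M X"
  \<comment> \<open>The bound \<open>e\<close> keeps the shifted tilt in S; the bound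
    \<open>\<delta>\<close> lets exp |hX| be absorbed by the margin.\<close>
  have bound: "\<bar>(?m n (\<theta> + h) - ?m n \<theta>) / h - ?m (Suc n) \<theta>\<bar> \<le> C * \<bar>h\<bar>"
    if h: "h \<noteq> 0" "\<bar>h\<bar> < min e \<delta>" for h
  proof -
    have "\<theta> + h \<in> S"
      using e h by (auto simp: dist_real_def subset_iff)
    let ?g = "\<lambda>\<omega>. X \<omega> ^ n * exp ((\<theta> + h) * X \<omega>) - X \<omega> ^ n * exp (\<theta> * X \<omega>)
          - h * (X \<omega> ^ Suc n * exp (\<theta> * X \<omega>))"
    have "\<bar>?m n (\<theta> + h) - ?m n \<theta> - h * ?m (Suc n) \<theta>\<bar> = \<bar>LINT \<omega>|M. ?g \<omega>\<bar>"
      unfolding tilted_moment_def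
      by (simp only: Bochner_Integration.integral_diff integral_mult_right_zero
          Bochner_Integration.integrable_diff integrable_mult_right
          tilted_moment_integrable[OF \<theta>] tilted_moment_integrable[OF \<open>\<theta> + h \<in> S\<close>])
    also have "\<dots> \<le> (LINT \<omega>|M. h\<^sup>2 * (\<bar>X \<omega>\<bar> ^ (n + 2) * exp (\<theta> * X \<omega> + \<delta> * \<bar>X \<omega>\<bar>)))"
    proof (rule order_trans[OF integral_abs_bound], rule integral_mono)
      show "integrable M (\<lambda>\<omega>. \<bar>?g \<omega>\<bar>)"
        using tilted_moment_integrable[OF \<theta>] tilted_moment_integrable[OF \<open>\<theta> + h \<in> S\<close>]
        by (intro integrable_abs Bochner_Integration.integrable_diff integrable_mult_right)
      show "integrable M (\<lambda>\<omega>. h\<^sup>2 * (\<bar>X \<omega>\<bar> ^ (n + 2) * exp (\<theta> * X \<omega> + \<delta> * \<bar>X \<omega>\<bar>)))"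
        using \<delta>(2) by (intro integrable_mult_right)
      show "\<bar>?g \<omega>\<bar> \<le> h\<^sup>2 * (\<bar>X \<omega>\<bar> ^ (n + 2) * exp (\<theta> * X \<omega> + \<delta> * \<bar>X \<omega>\<bar>))" for \<omega>
      proof -
        \<comment> \<open>The Taylor remainder of exp (hX) factors out; its square of X raises the
          power to n + 2, the one in \<open>C\<close>.\<close>
        have "?g \<omega> = X \<omega> ^ n * exp (\<theta> * X \<omega>) * (exp (h * X \<omega>) - 1 - h * X \<omega>)"
          by (simp add: exp_add algebra_simps)
        then have "\<bar>?g \<omega>\<bar> = \<bar>X \<omega>\<bar> ^ n * exp (\<theta> * X \<omega>) * \<bar>exp (h * X \<omega>) - 1 - h * X \<omega>\<bar>"
          by (simp only: abs_mult power_abs abs_exp_cancel)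
        also have "\<dots> \<le> \<bar>X \<omega>\<bar> ^ n * exp (\<theta> * X \<omega>) * ((h * X \<omega>)\<^sup>2 * exp (\<delta> * \<bar>X \<omega>\<bar>))"
        proof (intro mult_left_mono order_trans[OF exp_minus_one_minus_bound])
          show "exp \<bar>h * X \<omega>\<bar> \<le> exp (\<delta> * \<bar>X \<omega>\<bar>)"
            using h by (auto simp: abs_mult intro!: mult_right_mono)
        qed auto
        also have "\<dots> = h\<^sup>2 * (\<bar>X \<omega>\<bar> ^ (n + 2) * exp (\<theta> * X \<omega> + \<delta> * \<bar>X \<omega>\<bar>))"
          by (simp add: exp_add power_add power_mult_distrib power2_eq_square)
        finally show ?thesis .
      qed
    qed
    also have "\<dots> = h\<^sup>2 * C"
      by (simp only: C_def integral_mult_right_zero)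
    finally have le: "\<bar>?m n (\<theta> + h) - ?m n \<theta> - h * ?m (Suc n) \<theta>\<bar> \<le> h\<^sup>2 * C" .
    have "(?m n (\<theta> + h) - ?m n \<theta>) / h - ?m (Suc n) \<theta>
        = (?m n (\<theta> + h) - ?m n \<theta> - h * ?m (Suc n) \<theta>) / h"
      using h by (simp add: diff_divide_distrib)
    then have "\<bar>(?m n (\<theta> + h) - ?m n \<theta>) / h - ?m (Suc n) \<theta>\<bar>
        = \<bar>?m n (\<theta> + h) - ?m n \<theta> - h * ?m (Suc n) \<theta>\<bar> / \<bar>h\<bar>"
      by (simp only: abs_divide)
    also have "\<dots> \<le> h\<^sup>2 * C / \<bar>h\<bar>"
      using le by (intro divide_right_mono) auto
    also have "\<dots> = C * \<bar>h\<bar>"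
      using h by (cases "0 < h") (auto simp: power2_eq_square)
    finally show ?thesis .
  qed
  have "((\<lambda>h. (?m n (\<theta> + h) - ?m n \<theta>) / h - ?m (Suc n) \<theta>) \<longlongrightarrow> 0) (at 0)"
  proof (rule Lim_null_comparison)
    show "\<forall>\<^sub>F h in at 0. norm ((?m n (\<theta> + h) - ?m n \<theta>) / h - ?m (Suc n) \<theta>) \<le> C * \<bar>h\<bar>"
      unfolding eventually_at
    proof (intro exI[of _ "min e \<delta>"] conjI ballI impI)
      show "0 < min e \<delta>"
        using e \<delta> by simp
      fix h :: real
      assume "h \<noteq> 0 \<and> dist h 0 < min e \<delta>"
      then show "norm ((?m n (\<theta> + h) - ?m n \<theta>) / h - ?m (Suc n) \<theta>) \<le> C * \<bar>h\<bar>"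
        unfolding real_norm_def by (intro bound) auto
    qed
    show "((\<lambda>h. C * \<bar>h\<bar>) \<longlongrightarrow> 0) (at 0)"
      by (auto intro!: tendsto_eq_intros)
  qed
  then show ?thesis
    unfolding DERIV_def by (rule LIM_zero_cancel)
qed

end

section \<open>Expansions of the logarithm at infinity\<close>

text \<open>The scaled limits say that f' = y - 1/theta + o(1/theta) and that f'' is asymptotic to
  1/theta^2. The witnesses \<open>f1\<close> and \<open>f2\<close> carry the existence of the
  derivatives, and in this form the property can be passed on to other functions by the usual rules
  for limits.\<close>

definition log_tail_expansion :: "(real \<Rightarrow> real) \<Rightarrow> real \<Rightarrow> bool" where
  "log_tail_expansion f y \<longleftrightarrow> (\<exists>T f1 f2.
     (\<forall>\<theta>>T. (f has_real_derivative f1 \<theta>) (at \<theta>) \<and> (f1 has_real_derivative f2 \<theta>) (at \<theta>)) \<and>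
     ((\<lambda>\<theta>. \<theta> * (f1 \<theta> - y)) \<longlongrightarrow> -1) at_top \<and>
     ((\<lambda>\<theta>. \<theta>\<^sup>2 * f2 \<theta>) \<longlongrightarrow> 1) at_top)"

text \<open>Dividing by the value at theta = 0 shifts the logarithm by a constant, which the
  derivatives do not see.\<close>

lemma log_tail_expansion_add_const:
  assumes "log_tail_expansion f y" and eq: "\<And>\<theta>. \<theta> > T' \<Longrightarrow> g \<theta> = f \<theta> + c"
  shows "log_tail_expansion g y"
proof -
  obtain T f1 f2 where f: "\<And>\<theta>. \<theta> > T \<Longrightarrow> (f has_real_derivative f1 \<theta>) (at \<theta>)"
      "\<And>\<theta>. \<theta> > T \<Longrightarrow> (f1 has_real_derivative f2 \<theta>) (at \<theta>)"
      "((\<lambda>\<theta>. \<theta> * (f1 \<theta> - y)) \<longlongrightarrow> -1) at_top" "((\<lambda>\<theta>. \<theta>\<^sup>2 * f2 \<theta>) \<longlongrightarrow> 1) at_top"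
    using assms(1) unfolding log_tail_expansion_def by blast
  have "(g has_real_derivative f1 \<theta>) (at \<theta>)" if "\<theta> > max T T'" for \<theta>
  proof (rule has_field_derivative_transform_within_open[of "\<lambda>\<theta>. f \<theta> + c" _ _ "{T'<..}"])
    show "((\<lambda>\<theta>. f \<theta> + c) has_real_derivative f1 \<theta>) (at \<theta>)"
      using f(1)[of \<theta>] that by (auto intro!: derivative_eq_intros)
  qed (use that eq in auto)
  then show ?thesis
    unfolding log_tail_expansion_def using f
    by (intro exI[of _ "max T T'"] exI[of _ f1] exI[of _ f2]) simp
qed

lemma log_tail_expansion_limits:
  assumes "((\<lambda>\<theta>. \<theta> * (f1 \<theta> - y)) \<longlongrightarrow> -1) at_top" "((\<lambda>\<theta>. \<theta>\<^sup>2 * f2 \<theta>) \<longlongrightarrow> 1) at_top"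
  shows "(f1 \<longlongrightarrow> (y::real)) at_top" "(f2 \<longlongrightarrow> (0::real)) at_top"
proof -
  have inv: "((\<lambda>\<theta>::real. inverse \<theta>) \<longlongrightarrow> 0) at_top"
    by (rule tendsto_inverse_0_at_top[OF filterlim_ident])
  have "((\<lambda>\<theta>. \<theta> * (f1 \<theta> - y) * inverse \<theta> + y) \<longlongrightarrow> y) at_top"
    by (rule tendsto_eq_rhs[OF tendsto_add[OF tendsto_mult[OF assms(1) inv] tendsto_const]]) simp
  moreover have "\<forall>\<^sub>F \<theta> in at_top. \<theta> * (f1 \<theta> - y) * inverse \<theta> + y = f1 \<theta>"
    using eventually_gt_at_top[of 0] by eventually_elim (simp add: field_simps)
  ultimately show "(f1 \<longlongrightarrow> y) at_top"
    by (rule Lim_transform_eventually)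
  have "((\<lambda>\<theta>. \<theta>\<^sup>2 * f2 \<theta> * (inverse \<theta>)\<^sup>2) \<longlongrightarrow> 0) at_top"
    by (rule tendsto_eq_rhs[OF tendsto_mult[OF assms(2) tendsto_power[OF inv]]]) simp
  moreover have "\<forall>\<^sub>F \<theta> in at_top. \<theta>\<^sup>2 * f2 \<theta> * (inverse \<theta>)\<^sup>2 = f2 \<theta>"
    using eventually_gt_at_top[of 0] by eventually_elim (simp add: field_simps power2_eq_square)
  ultimately show "(f2 \<longlongrightarrow> 0) at_top"
    by (rule Lim_transform_eventually)
qed

text \<open>The new function is ln (exp g - exp f) with exp g factored out. With R = exp (f - g) one
  has R' = R (f' - g'), so every term that ln (1 - R) adds to the derivatives keeps a factor R,
  multiplied by quantities that converge. Decay of R faster than theta^-2 therefore suffices for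
  both limits.\<close>

lemma log_tail_expansion_subtract_small:
  assumes f: "log_tail_expansion f a" and g: "log_tail_expansion g b"
    and small: "((\<lambda>\<theta>. \<theta>\<^sup>2 * exp (f \<theta> - g \<theta>)) \<longlongrightarrow> 0) at_top"
  shows "log_tail_expansion (\<lambda>\<theta>. g \<theta> + ln (1 - exp (f \<theta> - g \<theta>))) b"
proof -
  obtain Tf f1 f2 where f: "\<And>\<theta>. \<theta> > Tf \<Longrightarrow> (f has_real_derivative f1 \<theta>) (at \<theta>)"
      "\<And>\<theta>. \<theta> > Tf \<Longrightarrow> (f1 has_real_derivative f2 \<theta>) (at \<theta>)"
      "((\<lambda>\<theta>. \<theta> * (f1 \<theta> - a)) \<longlongrightarrow> -1) at_top" "((\<lambda>\<theta>. \<theta>\<^sup>2 * f2 \<theta>) \<longlongrightarrow> 1) at_top"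
    using f unfolding log_tail_expansion_def by blast
  obtain Tg g1 g2 where g: "\<And>\<theta>. \<theta> > Tg \<Longrightarrow> (g has_real_derivative g1 \<theta>) (at \<theta>)"
      "\<And>\<theta>. \<theta> > Tg \<Longrightarrow> (g1 has_real_derivative g2 \<theta>) (at \<theta>)"
      "((\<lambda>\<theta>. \<theta> * (g1 \<theta> - b)) \<longlongrightarrow> -1) at_top" "((\<lambda>\<theta>. \<theta>\<^sup>2 * g2 \<theta>) \<longlongrightarrow> 1) at_top"
    using g unfolding log_tail_expansion_def by blast
  note lim_f = log_tail_expansion_limits[OF f(3,4)]
  note lim_g = log_tail_expansion_limits[OF g(3,4)]
  define R where "R \<theta> = exp (f \<theta> - g \<theta>)" for \<theta>
  have inv: "((\<lambda>\<theta>::real. inverse \<theta>) \<longlongrightarrow> 0) at_top"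
    by (rule tendsto_inverse_0_at_top[OF filterlim_ident])
  have R2: "((\<lambda>\<theta>. \<theta>\<^sup>2 * R \<theta>) \<longlongrightarrow> 0) at_top"
    using small by (simp add: R_def)
  have "((\<lambda>\<theta>. \<theta>\<^sup>2 * R \<theta> * inverse \<theta>) \<longlongrightarrow> 0) at_top"
    by (rule tendsto_eq_rhs[OF tendsto_mult[OF R2 inv]]) simp
  moreover have "\<forall>\<^sub>F \<theta> in at_top. \<theta>\<^sup>2 * R \<theta> * inverse \<theta> = \<theta> * R \<theta>"
    using eventually_gt_at_top[of 0] by eventually_elim (simp add: power2_eq_square)
  ultimately have R1: "((\<lambda>\<theta>. \<theta> * R \<theta>) \<longlongrightarrow> 0) at_top"
    by (rule Lim_transform_eventually)
  have "((\<lambda>\<theta>. \<theta> * R \<theta> * inverse \<theta>) \<longlongrightarrow> 0) at_top"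
    by (rule tendsto_eq_rhs[OF tendsto_mult[OF R1 inv]]) simp
  moreover have "\<forall>\<^sub>F \<theta> in at_top. \<theta> * R \<theta> * inverse \<theta> = R \<theta>"
    using eventually_gt_at_top[of 0] by eventually_elim simp
  ultimately have R0: "(R \<longlongrightarrow> 0) at_top"
    by (rule Lim_transform_eventually)
  then have "\<forall>\<^sub>F \<theta> in at_top. R \<theta> < 1"
    by (rule order_tendstoD) simp
  then obtain T0 where T0: "\<And>\<theta>. \<theta> > T0 \<Longrightarrow> R \<theta> < 1"
    by (auto simp: eventually_at_top_dense)
  define h1 where "h1 \<theta> = g1 \<theta> - R \<theta> * (f1 \<theta> - g1 \<theta>) / (1 - R \<theta>)" for \<theta>
  define h2 where "h2 \<theta> = g2 \<theta> - R \<theta> * ((f1 \<theta> - g1 \<theta>)\<^sup>2 + (f2 \<theta> - g2 \<theta>)) / (1 - R \<theta>)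
      - (R \<theta>)\<^sup>2 * (f1 \<theta> - g1 \<theta>)\<^sup>2 / (1 - R \<theta>)\<^sup>2" for \<theta>
  define T where "T = max T0 (max Tf Tg)"
  have dR: "(R has_real_derivative R \<theta> * (f1 \<theta> - g1 \<theta>)) (at \<theta>)" if "\<theta> > T" for \<theta>
    unfolding R_def using that f(1)[of \<theta>] g(1)[of \<theta>]
    by (auto simp: T_def intro!: derivative_eq_intros)
  have d1: "((\<lambda>\<theta>. g \<theta> + ln (1 - R \<theta>)) has_real_derivative h1 \<theta>) (at \<theta>)" if "\<theta> > T" for \<theta>
    using that T0[of \<theta>] dR[of \<theta>] g(1)[of \<theta>]
    by (auto simp: T_def h1_def intro!: derivative_eq_intros)
  have d2: "(h1 has_real_derivative h2 \<theta>) (at \<theta>)" if "\<theta> > T" for \<theta>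
  proof -
    have ne: "1 - R \<theta> \<noteq> 0"
      using T0[of \<theta>] that by (simp add: T_def)
    have "((\<lambda>\<theta>. g1 \<theta> - R \<theta> * (f1 \<theta> - g1 \<theta>) / (1 - R \<theta>)) has_real_derivative
        (g2 \<theta> - ((R \<theta> * (f1 \<theta> - g1 \<theta>) * (f1 \<theta> - g1 \<theta>) + (f2 \<theta> - g2 \<theta>) * R \<theta>) * (1 - R \<theta>)
          - R \<theta> * (f1 \<theta> - g1 \<theta>) * (0 - R \<theta> * (f1 \<theta> - g1 \<theta>))) / ((1 - R \<theta>) * (1 - R \<theta>)))) (at \<theta>)"
      using that f(2)[of \<theta>] g(2)[of \<theta>] ne
      by (intro DERIV_diff DERIV_divide DERIV_mult DERIV_const dR) (auto simp: T_def)
    also have "g2 \<theta> - ((R \<theta> * (f1 \<theta> - g1 \<theta>) * (f1 \<theta> - g1 \<theta>) + (f2 \<theta> - g2 \<theta>) * R \<theta>) * (1 - R \<theta>)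
          - R \<theta> * (f1 \<theta> - g1 \<theta>) * (0 - R \<theta> * (f1 \<theta> - g1 \<theta>))) / ((1 - R \<theta>) * (1 - R \<theta>)) = h2 \<theta>"
      unfolding h2_def using ne by (simp add: divide_simps power2_eq_square) (simp add: algebra_simps)
    finally show ?thesis
      unfolding h1_def .
  qed
  \<comment> \<open>Each correction is theta R, or theta^2 R for the second derivative, times a
    factor that converges because f1, g1, f2 and g2 do.\<close>
  have "((\<lambda>\<theta>. \<theta> * (g1 \<theta> - b) - \<theta> * R \<theta> * (f1 \<theta> - g1 \<theta>) / (1 - R \<theta>))
      \<longlongrightarrow> -1 - 0 * (a - b) / (1 - 0)) at_top"
    by (intro tendsto_intros g(3) R1 R0 lim_f lim_g) simp
  then have l1: "((\<lambda>\<theta>. \<theta> * (h1 \<theta> - b)) \<longlongrightarrow> -1) at_top"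
    by (simp add: h1_def algebra_simps)
  have "((\<lambda>\<theta>. \<theta>\<^sup>2 * g2 \<theta> - \<theta>\<^sup>2 * R \<theta> * ((f1 \<theta> - g1 \<theta>)\<^sup>2 + (f2 \<theta> - g2 \<theta>)) / (1 - R \<theta>)
      - \<theta>\<^sup>2 * R \<theta> * (R \<theta> * (f1 \<theta> - g1 \<theta>)\<^sup>2) / (1 - R \<theta>)\<^sup>2)
      \<longlongrightarrow> 1 - 0 * ((a - b)\<^sup>2 + (0 - 0)) / (1 - 0) - 0 * (0 * (a - b)\<^sup>2) / (1 - 0)\<^sup>2) at_top"
    by (intro tendsto_intros g(4) R2 R0 lim_f lim_g) simp_all
  then have l2: "((\<lambda>\<theta>. \<theta>\<^sup>2 * h2 \<theta>) \<longlongrightarrow> 1) at_top"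
    by (simp add: h2_def right_diff_distrib power2_eq_square mult_ac)
  show ?thesis
    using d1 d2 l1 l2 unfolding log_tail_expansion_def R_def
    by (intro exI[of _ T] exI[of _ h1] exI[of _ h2]) auto
qed

section \<open>From the scaled limits to statements about \<open>deriv\<close>, at both
  infinities\<close>

lemma log_tail_expansion_derivs:
  assumes "log_tail_expansion f y"
  obtains T f1 f2 where
    "\<And>\<theta>. \<theta> > T \<Longrightarrow> (f has_real_derivative f1 \<theta>) (at \<theta>)"
    "\<And>\<theta>. \<theta> > T \<Longrightarrow> (f1 has_real_derivative f2 \<theta>) (at \<theta>)"
    "\<And>\<theta>. \<theta> > T \<Longrightarrow> (deriv f has_real_derivative f2 \<theta>) (at \<theta>)"
    "((\<lambda>\<theta>. \<theta> * (f1 \<theta> - y)) \<longlongrightarrow> -1) at_top" "((\<lambda>\<theta>. \<theta>\<^sup>2 * f2 \<theta>) \<longlongrightarrow> 1) at_top"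
proof -
  obtain T f1 f2 where f: "\<And>\<theta>. \<theta> > T \<Longrightarrow> (f has_real_derivative f1 \<theta>) (at \<theta>)"
      "\<And>\<theta>. \<theta> > T \<Longrightarrow> (f1 has_real_derivative f2 \<theta>) (at \<theta>)"
      "((\<lambda>\<theta>. \<theta> * (f1 \<theta> - y)) \<longlongrightarrow> -1) at_top" "((\<lambda>\<theta>. \<theta>\<^sup>2 * f2 \<theta>) \<longlongrightarrow> 1) at_top"
    using assms unfolding log_tail_expansion_def by blast
  have "(deriv f has_real_derivative f2 \<theta>) (at \<theta>)" if "\<theta> > T" for \<theta>
    by (rule has_field_derivative_transform_within_open[of f1 _ _ "{T<..}"])
      (use that f(2) in \<open>auto simp: DERIV_imp_deriv[OF f(1)]\<close>)
  from f(1,2) this f(3,4) show ?thesis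
    by (rule that)
qed

lemma log_tail_expansion_at_top:
  assumes "log_tail_expansion f y"
  shows "eventually_twice_differentiable f at_top"
    and "(\<lambda>\<theta>. deriv f \<theta> - (y - inverse \<theta>)) \<in> o[at_top](\<lambda>\<theta>. inverse \<theta>)"
    and "((\<lambda>\<theta>. deriv (deriv f) \<theta> / inverse (\<theta>\<^sup>2)) \<longlongrightarrow> 1) at_top"
proof -
  obtain T f1 f2 where f: "\<And>\<theta>. \<theta> > T \<Longrightarrow> (f has_real_derivative f1 \<theta>) (at \<theta>)"
    "\<And>\<theta>. \<theta> > T \<Longrightarrow> (f1 has_real_derivative f2 \<theta>) (at \<theta>)"
    "\<And>\<theta>. \<theta> > T \<Longrightarrow> (deriv f has_real_derivative f2 \<theta>) (at \<theta>)"
    "((\<lambda>\<theta>. \<theta> * (f1 \<theta> - y)) \<longlongrightarrow> -1) at_top" "((\<lambda>\<theta>. \<theta>\<^sup>2 * f2 \<theta>) \<longlongrightarrow> 1) at_top"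
    using log_tail_expansion_derivs[OF assms] by blast
  show "eventually_twice_differentiable f at_top"
    unfolding eventually_twice_differentiable_def
    using eventually_gt_at_top[of T] by eventually_elim (use f(1,3) in \<open>auto simp: real_differentiable_def\<close>)
  show "(\<lambda>\<theta>. deriv f \<theta> - (y - inverse \<theta>)) \<in> o[at_top](\<lambda>\<theta>. inverse \<theta>)"
  proof (rule smalloI_tendsto)
    have "((\<lambda>\<theta>. \<theta> * (f1 \<theta> - y) + 1) \<longlongrightarrow> 0) at_top"
      using tendsto_add[OF f(4) tendsto_const[of 1]] by simp
    moreover have "\<forall>\<^sub>F \<theta> in at_top. \<theta> * (f1 \<theta> - y) + 1
        = (deriv f \<theta> - (y - inverse \<theta>)) / inverse \<theta>"
      using eventually_gt_at_top[of T] eventually_gt_at_top[of 0]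
      by eventually_elim (simp add: DERIV_imp_deriv[OF f(1)] field_simps)
    ultimately show "((\<lambda>\<theta>. (deriv f \<theta> - (y - inverse \<theta>)) / inverse \<theta>) \<longlongrightarrow> 0) at_top"
      by (rule Lim_transform_eventually)
    show "\<forall>\<^sub>F \<theta> in at_top. inverse (\<theta>::real) \<noteq> 0"
      using eventually_gt_at_top[of 0] by eventually_elim simp
  qed
  have "\<forall>\<^sub>F \<theta> in at_top. \<theta>\<^sup>2 * f2 \<theta> = deriv (deriv f) \<theta> / inverse (\<theta>\<^sup>2)"
    using eventually_gt_at_top[of T]
    by eventually_elim (simp add: DERIV_imp_deriv[OF f(3)] field_simps)
  with f(5) show "((\<lambda>\<theta>. deriv (deriv f) \<theta> / inverse (\<theta>\<^sup>2)) \<longlongrightarrow> 1) at_top"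
    by (rule Lim_transform_eventually)
qed

text \<open>The expansion is stable under reflection: the first derivative changes sign together
  with y and with the odd term 1/theta, while the second derivative and 1/theta^2 are even.\<close>

lemma log_tail_expansion_at_bot:
  assumes "log_tail_expansion (\<lambda>\<theta>. f (- \<theta>)) (- y)"
  shows "eventually_twice_differentiable f at_bot"
    and "(\<lambda>\<theta>. deriv f \<theta> - (y - inverse \<theta>)) \<in> o[at_bot](\<lambda>\<theta>. inverse \<theta>)"
    and "((\<lambda>\<theta>. deriv (deriv f) \<theta> / inverse (\<theta>\<^sup>2)) \<longlongrightarrow> 1) at_bot"
proof -
  let ?g = "\<lambda>\<theta>. f (- \<theta>)"
  obtain T g1 g2 where g: "\<And>\<theta>. \<theta> > T \<Longrightarrow> (?g has_real_derivative g1 \<theta>) (at \<theta>)"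
    "\<And>\<theta>. \<theta> > T \<Longrightarrow> (g1 has_real_derivative g2 \<theta>) (at \<theta>)"
    "((\<lambda>\<theta>. \<theta> * (g1 \<theta> - (- y))) \<longlongrightarrow> -1) at_top" "((\<lambda>\<theta>. \<theta>\<^sup>2 * g2 \<theta>) \<longlongrightarrow> 1) at_top"
    using assms unfolding log_tail_expansion_def by blast
  have d1: "(f has_real_derivative - g1 (- \<theta>)) (at \<theta>)" if "\<theta> < - T" for \<theta>
  proof -
    have "(?g has_real_derivative g1 (- \<theta>)) (at (- \<theta>))"
      using g(1)[of "- \<theta>"] that by simp
    then have "((\<lambda>x. ?g (- x)) has_real_derivative - g1 (- \<theta>)) (at \<theta>)"
      by (subst (asm) DERIV_mirror) simp
    then show ?thesis
      by simp
  qed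
  have d2: "(deriv f has_real_derivative g2 (- \<theta>)) (at \<theta>)" if "\<theta> < - T" for \<theta>
  proof (rule has_field_derivative_transform_within_open[of "\<lambda>\<theta>. - g1 (- \<theta>)" _ _ "{..<-T}"])
    have "((\<lambda>x. g1 (- x)) has_real_derivative - g2 (- \<theta>)) (at \<theta>)"
      using g(2)[of "- \<theta>"] that by (subst DERIV_mirror[symmetric]) simp
    then show "((\<lambda>\<theta>. - g1 (- \<theta>)) has_real_derivative g2 (- \<theta>)) (at \<theta>)"
      using DERIV_minus by fastforce
  qed (use that in \<open>auto simp: DERIV_imp_deriv[OF d1]\<close>)
  show "eventually_twice_differentiable f at_bot"
    unfolding eventually_twice_differentiable_def
    using eventually_gt_at_bot[of "-T"]
    by eventually_elim (use d1 d2 in \<open>auto simp: real_differentiable_def\<close>)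
  show "(\<lambda>\<theta>. deriv f \<theta> - (y - inverse \<theta>)) \<in> o[at_bot](\<lambda>\<theta>. inverse \<theta>)"
  proof (rule smalloI_tendsto)
    have "((\<lambda>\<theta>. \<theta> * (g1 \<theta> - (- y)) + 1) \<longlongrightarrow> 0) at_top"
      using tendsto_add[OF g(3) tendsto_const[of 1]] by simp
    moreover have "\<forall>\<^sub>F \<theta> in at_top. \<theta> * (g1 \<theta> - (- y)) + 1
        = (deriv f (- \<theta>) - (y - inverse (- \<theta>))) / inverse (- \<theta>)"
      using eventually_gt_at_top[of T] eventually_gt_at_top[of 0]
      by eventually_elim (simp add: DERIV_imp_deriv[OF d1] field_simps)
    ultimately have "((\<lambda>\<theta>. (deriv f (- \<theta>) - (y - inverse (- \<theta>))) / inverse (- \<theta>)) \<longlongrightarrow> 0) at_top"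
      by (rule Lim_transform_eventually)
    then show "((\<lambda>\<theta>. (deriv f \<theta> - (y - inverse \<theta>)) / inverse \<theta>) \<longlongrightarrow> 0) at_bot"
      by (simp only: filterlim_at_bot_mirror)
    show "\<forall>\<^sub>F \<theta> in at_bot. inverse (\<theta>::real) \<noteq> 0"
      using eventually_gt_at_bot[of 0] by eventually_elim simp
  qed
  have "\<forall>\<^sub>F \<theta> in at_top. \<theta>\<^sup>2 * g2 \<theta> = deriv (deriv f) (- \<theta>) / inverse ((- \<theta>)\<^sup>2)"
    using eventually_gt_at_top[of T]
    by eventually_elim (simp add: DERIV_imp_deriv[OF d2] field_simps)
  with g(4) have "((\<lambda>\<theta>. deriv (deriv f) (- \<theta>) / inverse ((- \<theta>)\<^sup>2)) \<longlongrightarrow> 1) at_top"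
    by (rule Lim_transform_eventually)
  then show "((\<lambda>\<theta>. deriv (deriv f) \<theta> / inverse (\<theta>\<^sup>2)) \<longlongrightarrow> 1) at_bot"
    by (simp only: filterlim_at_bot_mirror)
qed

section \<open>Saddlepoints of a steep cumulant generating function\<close>

text \<open>Steepness enters as surjectivity of \<open>K1\<close>, the form in which the saddlepoint
  equations use it. The fourth derivative is only ever evaluated along s1(theta), where continuity
  yields its limit.\<close>

locale steep_cgf =
  fixes K K1 K2 K3 K4 :: "real \<Rightarrow> real" and S :: "real set"
  assumes open_S: "open S" and interval_S: "is_interval S" and zero_S: "0 \<in> S"
    and K_deriv: "\<And>t. t \<in> S \<Longrightarrow> (K has_real_derivative K1 t) (at t)"
    and K1_deriv: "\<And>t. t \<in> S \<Longrightarrow> (K1 has_real_derivative K2 t) (at t)"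
    and K2_deriv: "\<And>t. t \<in> S \<Longrightarrow> (K2 has_real_derivative K3 t) (at t)"
    and K3_deriv: "\<And>t. t \<in> S \<Longrightarrow> (K3 has_real_derivative K4 t) (at t)"
    and K4_cont: "continuous_on S K4"
    and K2_pos: "\<And>t. t \<in> S \<Longrightarrow> 0 < K2 t"
    and K1_onto: "\<And>y. \<exists>t\<in>S. K1 t = y"
begin

section \<open>The saddlepoint and the continuity of the saddlepoint density\<close>

lemma deriv_K: "t \<in> S \<Longrightarrow> deriv K t = K1 t"
  by (rule DERIV_imp_deriv[OF K_deriv])

lemma deriv2_K:
  assumes "t \<in> S"
  shows "deriv (deriv K) t = K2 t"
proof (rule DERIV_imp_deriv)
  show "(deriv K has_real_derivative K2 t) (at t)"
    by (rule has_field_derivative_transform_within_open[OF K1_deriv open_S])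
      (use assms in \<open>auto simp: deriv_K\<close>)
qed

lemma mem_S_between: "s \<in> S \<Longrightarrow> t \<in> S \<Longrightarrow> s \<le> x \<Longrightarrow> x \<le> t \<Longrightarrow> x \<in> S"
  using interval_S unfolding is_interval_1 by blast

lemma K1_less:
  assumes "s \<in> S" "t \<in> S" "s < t"
  shows "K1 s < K1 t"
  by (rule DERIV_pos_imp_increasing[OF assms(3)])
    (meson K1_deriv K2_pos mem_S_between assms)

lemma K1_le: "s \<in> S \<Longrightarrow> t \<in> S \<Longrightarrow> s \<le> t \<Longrightarrow> K1 s \<le> K1 t"
  using K1_less[of s t] by (cases "s = t") auto

lemma K1_less_iff: "s \<in> S \<Longrightarrow> t \<in> S \<Longrightarrow> K1 s < K1 t \<longleftrightarrow> s < t"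
  using K1_less[of s t] K1_le[of t s] by (auto simp: not_le[symmetric])

lemma saddlepoint_eqI:
  assumes "t \<in> S" "K1 t = y"
  shows "saddlepoint K S y = t"
  unfolding saddlepoint_def
proof (rule the_equality)
  show "s = t" if "s \<in> S \<and> deriv K s = y" for s
    using that assms K1_less[of s t] K1_less[of t s] by (cases s t rule: linorder_cases) (auto simp: deriv_K)
qed (use assms in \<open>auto simp: deriv_K\<close>)

lemma saddlepoint_in: "saddlepoint K S y \<in> S"
  and K1_saddlepoint [simp]: "K1 (saddlepoint K S y) = y"
  using K1_onto[of y] saddlepoint_eqI[of _ y] by auto

text \<open>The saddlepoint map inverts \<open>K1\<close>, whose derivative \<open>K2\<close> is
  nonzero, so the inverse function theorem makes it differentiable and in particular
  continuous.\<close>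

lemma isCont_saddlepoint: "isCont (saddlepoint K S) y"
proof -
  let ?t = "saddlepoint K S y"
  have "(saddlepoint K S has_derivative (*) (inverse (K2 ?t))) (at y)"
  proof (rule has_derivative_inverse_strong_x[where f = K1 and f' = "(*) (K2 ?t)"])
    show "open S" "?t \<in> S"
      by (fact open_S saddlepoint_in)+
    show "continuous_on S K1"
      using K1_deriv by (meson DERIV_isCont continuous_at_imp_continuous_on)
    show "(K1 has_derivative (*) (K2 ?t)) (at ?t)"
      using K1_deriv[OF saddlepoint_in] by (simp add: has_field_derivative_def)
    show "(*) (K2 ?t) \<circ> (*) (inverse (K2 ?t)) = id"
      using K2_pos[OF saddlepoint_in, of y] by (auto simp: fun_eq_iff)
  qed (auto intro: saddlepoint_eqI)
  then show ?thesis
    by (rule has_derivative_continuous)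
qed

lemma saddlepoint_density_eq:
  "saddlepoint_density K S y = (2 * pi * K2 (saddlepoint K S y)) powr (- 1 / 2)
    * exp (K (saddlepoint K S y) - saddlepoint K S y * y)"
  by (simp add: saddlepoint_density_def Let_def deriv2_K saddlepoint_in)

lemma saddlepoint_density_pos: "0 < saddlepoint_density K S y"
  using K2_pos[OF saddlepoint_in, of y] by (simp add: saddlepoint_density_eq)

lemma isCont_saddlepoint_density: "isCont (saddlepoint_density K S) y"
proof -
  have "isCont (\<lambda>y. K2 (saddlepoint K S y)) y" "isCont (\<lambda>y. K (saddlepoint K S y)) y"
    using isCont_o2[OF isCont_saddlepoint] DERIV_isCont K2_deriv K_deriv saddlepoint_in by blast+
  moreover have "2 * pi * K2 (saddlepoint K S y) \<noteq> 0"
    using K2_pos[OF saddlepoint_in, of y] by simp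
  ultimately show ?thesis
    using isCont_saddlepoint[of y] unfolding saddlepoint_density_eq[abs_def] isCont_def
    by (intro tendsto_intros) auto
qed

text \<open>Continuity makes both one-sided limits exist and equal the value at y, which determines
  the description \<open>Lim\<close>.\<close>

lemma Lim_saddlepoint_density:
  shows "Lim (at_left y) (saddlepoint_density K S) = saddlepoint_density K S y"
    and "Lim (at_right y) (saddlepoint_density K S) = saddlepoint_density K S y"
  using isCont_saddlepoint_density[of y]
  by (auto intro!: tendsto_Lim simp: isCont_def filterlim_at_split)

section \<open>The equation defining \<open>s1\<close>: unique solvability and dependence on
  theta\<close>

lemma steep_equation_less:
  assumes "s \<in> S" "t \<in> S" "s < t" "t < \<theta>"
  shows "K1 s + 1 / (\<theta> - s) < K1 t + 1 / (\<theta> - t)"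
  using K1_less[OF assms(1-3)] assms by (intro add_strict_mono divide_strict_left_mono) auto

lemma s1_eqI:
  assumes "s \<in> S" "s < \<theta>" "K1 s + 1 / (\<theta> - s) = y"
  shows "s1 K S \<theta> y = s"
  unfolding s1_def
proof (rule the_equality)
  show "r = s" if "r \<in> S \<and> r < \<theta> \<and> deriv K r + 1 / (\<theta> - r) = y" for r
    using that assms steep_equation_less[of r s \<theta>] steep_equation_less[of s r \<theta>]
    by (cases r s rule: linorder_cases) (auto simp: deriv_K)
qed (use assms in \<open>auto simp: deriv_K\<close>)

text \<open>Intermediate value theorem between a point \<open>l\<close> far to the left, where
  \<open>K1\<close> is very negative and the fraction stays bounded, and a point \<open>r\<close>
  left of theta, where either \<open>K1\<close> has reached y or the fraction has become
  large.\<close>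

lemma steep_equation_solvable:
  assumes "0 \<le> \<theta>"
  shows "\<exists>s\<in>S. s < \<theta> \<and> K1 s + 1 / (\<theta> - s) = y"
proof -
  obtain e where e: "0 < e" "cball 0 e \<subseteq> S"
    using open_S zero_S open_contains_cball by blast
  \<comment> \<open>A reference point of S that is negative, hence left of theta even for theta =
    0.\<close>
  define p where "p = - e"
  have p: "p \<in> S" "p < \<theta>"
    using e assms by (auto simp: p_def dist_real_def subset_iff)
  \<comment> \<open>Being below \<open>K1 p\<close> forces l < p, which bounds the fraction at l by
    its value at p; being below y minus that value then keeps the whole left side under y.\<close>
  obtain l where l: "l \<in> S" "K1 l = min (K1 p) (y - 1 / (\<theta> - p)) - 1"
    using K1_onto by blast
  have "l < p"
    using l p K1_less_iff[of l p] by auto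
  then have "1 / (\<theta> - l) \<le> 1 / (\<theta> - p)"
    using p by (intro divide_left_mono) auto
  then have low: "K1 l + 1 / (\<theta> - l) < y"
    using l(2) by linarith
  obtain r where r: "r \<in> S" "p \<le> r" "r < \<theta>" "y < K1 r + 1 / (\<theta> - r)"
  \<comment> \<open>If the saddlepoint lies left of theta, \<open>K1\<close> is at least y there and
    the positive fraction makes the inequality strict. Otherwise theta is at most the saddlepoint,
    so the points between p and theta lie in S and the pole at theta can be approached.\<close>
  proof (cases "max p (saddlepoint K S y) < \<theta>")
    case True
    let ?r = "max p (saddlepoint K S y)"
    have "?r \<in> S"
      using p saddlepoint_in by (auto simp: max_def)
    moreover have "y \<le> K1 ?r"
      using K1_le[OF saddlepoint_in[of y] \<open>?r \<in> S\<close>] by simp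
    moreover have "0 < 1 / (\<theta> - ?r)"
      using True by simp
    ultimately show ?thesis
      using True that[of ?r] by linarith
  next
    case False
    then have \<theta>: "\<theta> \<le> saddlepoint K S y"
      using p by auto
    \<comment> \<open>The value c exceeds the deficit y - K1 p, and the fraction is at least c
      within distance 1/c of theta; the maximum with p in \<open>r\<close> keeps \<open>K1 r\<close>
      at least \<open>K1 p\<close>.\<close>
    define c where "c = \<bar>y - K1 p\<bar> + 1"
    define r where "r = max p (\<theta> - 1 / c)"
    have c: "0 < c" "y - K1 p < c"
      by (auto simp: c_def)
    have "r < \<theta>" "p \<le> r"
      using p c by (auto simp: r_def)
    then have "r \<in> S"
      using mem_S_between[OF p(1) saddlepoint_in[of y], of r] \<theta> by auto
    have "c \<le> 1 / (\<theta> - r)"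
      using c \<open>r < \<theta>\<close> by (simp add: r_def max_def field_simps split: if_splits)
    moreover have "K1 p \<le> K1 r"
      using K1_le p \<open>r \<in> S\<close> \<open>p \<le> r\<close> by blast
    ultimately have "y < K1 r + 1 / (\<theta> - r)"
      using c by linarith
    with \<open>r \<in> S\<close> \<open>p \<le> r\<close> \<open>r < \<theta>\<close> show ?thesis
      using that by blast
  qed
  have between: "x \<in> S \<and> x < \<theta>" if "l \<le> x" "x \<le> r" for x
    using that mem_S_between[OF l(1) r(1)] r(3) by auto
  have "\<exists>s\<ge>l. s \<le> r \<and> K1 s + 1 / (\<theta> - s) = y"
  proof (rule IVT')
    show "continuous_on {l..r} (\<lambda>s. K1 s + 1 / (\<theta> - s))"
      by (intro continuous_at_imp_continuous_on ballI continuous_intros DERIV_isCont[OF K1_deriv])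
        (use between in force)+
  qed (use low r \<open>l < p\<close> in auto)
  with between show ?thesis
    by blast
qed

lemma s1_spec:
  assumes "0 \<le> \<theta>"
  shows "s1 K S \<theta> y \<in> S" "s1 K S \<theta> y < \<theta>" "K1 (s1 K S \<theta> y) + 1 / (\<theta> - s1 K S \<theta> y) = y"
  using steep_equation_solvable[OF assms, of y] s1_eqI[of _ \<theta> y] by auto

lemma s1_less_saddlepoint:
  assumes "0 \<le> \<theta>"
  shows "s1 K S \<theta> y < saddlepoint K S y"
proof -
  have "0 < 1 / (\<theta> - s1 K S \<theta> y)"
    using s1_spec(2)[OF assms, of y] by simp
  then have "K1 (s1 K S \<theta> y) < y"
    using s1_spec(3)[OF assms, of y] by linarith
  then have "K1 (s1 K S \<theta> y) < K1 (saddlepoint K S y)"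
    by simp
  then show ?thesis
    by (subst (asm) K1_less_iff) (auto intro: s1_spec[OF assms] saddlepoint_in)
qed

text \<open>The root is always below the saddlepoint. Conversely, at a fixed d below the saddlepoint
  \<open>K1 d\<close> is less than y by a fixed amount, which the fraction 1 / (theta - d) cannot
  make up once theta is large; monotonicity then puts the root to the right of d.\<close>

lemma tendsto_s1: "((\<lambda>\<theta>. s1 K S \<theta> y) \<longlongrightarrow> saddlepoint K S y) at_top"
proof (rule order_tendstoI)
  fix c
  assume "saddlepoint K S y < c"
  then show "\<forall>\<^sub>F \<theta> in at_top. s1 K S \<theta> y < c"
    by (intro eventually_mono[OF eventually_ge_at_top[of 0]])
      (auto intro: order.strict_trans[OF s1_less_saddlepoint])
next
  fix c
  assume "c < saddlepoint K S y"
  moreover obtain e where "0 < e" "cball (saddlepoint K S y) e \<subseteq> S"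
    using open_S saddlepoint_in open_contains_cball by blast
  \<comment> \<open>The level c may lie outside S, so it is raised to a point of S that is still
    below the saddlepoint.\<close>
  ultimately obtain d where d: "c \<le> d" "d < saddlepoint K S y" "d \<in> S"
    by (intro that[of "max c (saddlepoint K S y - e)"]) (auto simp: dist_real_def subset_iff max_def)
  have "K1 d < y"
    using K1_less[OF d(3) saddlepoint_in d(2)] by simp
  \<comment> \<open>This threshold is where 1 / (theta - d) drops below y - K1 d.\<close>
  have "\<forall>\<^sub>F \<theta> in at_top. d + 1 / (y - K1 d) < \<theta>"
    by (rule eventually_gt_at_top)
  with eventually_ge_at_top[of 0] show "\<forall>\<^sub>F \<theta> in at_top. c < s1 K S \<theta> y"
  proof eventually_elim
    case (elim \<theta>)
    have "0 < 1 / (y - K1 d)"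
      using \<open>K1 d < y\<close> by simp
    then have "d < \<theta>"
      using elim by linarith
    have "1 / (\<theta> - d) < y - K1 d"
      using elim \<open>K1 d < y\<close> \<open>d < \<theta>\<close> by (simp add: field_simps)
    have "d < s1 K S \<theta> y"
    proof (rule ccontr)
      assume "\<not> d < s1 K S \<theta> y"
      then have "s1 K S \<theta> y = d \<or> s1 K S \<theta> y < d"
        by auto
      then have "y \<le> K1 d + 1 / (\<theta> - d)"
        using steep_equation_less[OF s1_spec(1)[OF elim(1), of y] d(3) _ \<open>d < \<theta>\<close>]
          s1_spec(3)[OF elim(1), of y] by auto
      with \<open>1 / (\<theta> - d) < y - K1 d\<close> show False
        by linarith
    qed
    with d show ?case
      by simp
  qed
qed

text \<open>On \<open>s < saddlepoint K S y\<close> the equation defining \<open>s1\<close> can be solved for \<open>\<theta>\<close>, so that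
  \<open>s1\<close> is the inverse of an explicit function of \<open>s\<close>.\<close>

lemma s1_has_derivative:
  fixes \<theta> y :: real
  assumes "0 \<le> \<theta>"
  defines "s \<equiv> s1 K S \<theta> y"
  shows "((\<lambda>\<theta>. s1 K S \<theta> y) has_real_derivative inverse (1 + (\<theta> - s)\<^sup>2 * K2 s)) (at \<theta>)"
proof -
  let ?t = "saddlepoint K S y" and ?Q = "1 + (\<theta> - s)\<^sup>2 * K2 s"
  define g where "g r = r + 1 / (y - K1 r)" for r
  \<comment> \<open>Left of the saddlepoint y - K1 r is positive, so \<open>g\<close> is
    differentiable and g r > r; the side condition of \<open>s1\<close> is thus automatic and
    \<open>s1\<close> inverts \<open>g\<close> on all of \<open>D\<close>.\<close>
  define D where "D = S \<inter> {..<?t}"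
  note s = s1_spec[OF assms(1), of y, folded s_def]
  have below: "r \<in> S" "K1 r < y" if "r \<in> D" for r
    using that K1_less[OF _ saddlepoint_in, of r y] by (auto simp: D_def)
  have g': "(g has_real_derivative 1 + K2 r / (y - K1 r)\<^sup>2) (at r)" if "r \<in> D" for r
    unfolding g_def using below[OF that]
    by (auto intro!: derivative_eq_intros K1_deriv simp: power2_eq_square)
  have "s \<in> D"
    using s(1) s1_less_saddlepoint[OF assms(1)] by (simp add: D_def s_def)
  \<comment> \<open>This turns the derivative 1 + K2 s / (y - K1 s)^2 of \<open>g\<close> at s into
    \<open>?Q\<close>.\<close>
  have u: "\<theta> - s = 1 / (y - K1 s)"
  proof -
    have "y - K1 s = 1 / (\<theta> - s)"
      using s(3) by linarith
    then show ?thesis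
      by simp
  qed
  have "0 < ?Q"
    using K2_pos[OF s(1)] by (intro add_pos_nonneg) auto
  have "((\<lambda>\<theta>. s1 K S \<theta> y) has_derivative (*) (inverse ?Q)) (at \<theta>)"
  proof (rule has_derivative_inverse_strong_x[where f = g and f' = "(*) ?Q" and S = D])
    show "open D"
      using open_S by (auto simp: D_def)
    show "s1 K S \<theta> y \<in> D"
      using \<open>s \<in> D\<close> by (simp add: s_def)
    show "continuous_on D g"
      using g' by (meson DERIV_isCont continuous_at_imp_continuous_on)
    show "s1 K S (g r) y = r" if "r \<in> D" for r
      using below[OF that] by (intro s1_eqI) (auto simp: g_def)
    show "(g has_derivative (*) ?Q) (at (s1 K S \<theta> y))"
      using g'[OF \<open>s \<in> D\<close>] unfolding u has_field_derivative_def s_def[symmetric]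
      by (simp add: power_divide)
    show "(*) ?Q \<circ> (*) (inverse ?Q) = id"
      using \<open>0 < ?Q\<close> by (simp add: fun_eq_iff)
    show "g (s1 K S \<theta> y) = \<theta>"
      using u by (simp add: g_def s_def[symmetric])
  qed
  then show ?thesis
    by (simp add: has_field_derivative_def)
qed

lemma Xi1_eq:
  fixes \<theta> y :: real
  assumes "0 \<le> \<theta>"
  defines "s \<equiv> s1 K S \<theta> y"
  shows "Xi1 K S \<theta> y = (2 * pi * (1 + (\<theta> - s)\<^sup>2 * K2 s)) powr (- 1 / 2) * exp (K s - (s - \<theta>) * y)"
  using s1_spec(1)[OF assms(1), of y] by (simp add: Xi1_def Xi_at_def s_def deriv2_K)

lemma Xi1_pos:
  assumes "0 \<le> \<theta>"
  shows "0 < Xi1 K S \<theta> y"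
proof -
  have "0 < 1 + (\<theta> - s1 K S \<theta> y)\<^sup>2 * K2 (s1 K S \<theta> y)"
    using K2_pos[OF s1_spec(1)[OF assms, of y]] by (intro add_pos_nonneg) auto
  then show ?thesis
    using assms by (simp add: Xi1_eq)
qed

section \<open>Tail behaviour of the approximations\<close>

lemma tendsto_s1_gap_ratio: "((\<lambda>\<theta>. (\<theta> - s1 K S \<theta> y) / \<theta>) \<longlongrightarrow> 1) at_top"
proof -
  have "((\<lambda>\<theta>. 1 - s1 K S \<theta> y * inverse \<theta>) \<longlongrightarrow> 1 - saddlepoint K S y * 0) at_top"
    by (intro tendsto_intros tendsto_s1 tendsto_inverse_0_at_top filterlim_ident)
  then have "((\<lambda>\<theta>. 1 - s1 K S \<theta> y * inverse \<theta>) \<longlongrightarrow> 1) at_top"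
    by simp
  moreover have "\<forall>\<^sub>F \<theta> in at_top. 1 - s1 K S \<theta> y * inverse \<theta> = (\<theta> - s1 K S \<theta> y) / \<theta>"
    using eventually_gt_at_top[of 0] by eventually_elim (simp add: field_simps)
  ultimately show ?thesis
    by (rule Lim_transform_eventually)
qed

lemma tendsto_scaled_denominator:
  "((\<lambda>\<theta>. (1 + (\<theta> - s1 K S \<theta> y)\<^sup>2 * K2 (s1 K S \<theta> y)) / \<theta>\<^sup>2) \<longlongrightarrow> K2 (saddlepoint K S y)) at_top"
proof -
  have "((\<lambda>\<theta>. K2 (s1 K S \<theta> y)) \<longlongrightarrow> K2 (saddlepoint K S y)) at_top"
    by (rule isCont_tendsto_compose[OF DERIV_isCont[OF K2_deriv] tendsto_s1]) (rule saddlepoint_in)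
  then have "((\<lambda>\<theta>. (inverse \<theta>)\<^sup>2 + ((\<theta> - s1 K S \<theta> y) / \<theta>)\<^sup>2 * K2 (s1 K S \<theta> y))
      \<longlongrightarrow> 0\<^sup>2 + 1\<^sup>2 * K2 (saddlepoint K S y)) at_top"
    by (intro tendsto_intros tendsto_s1_gap_ratio tendsto_inverse_0_at_top filterlim_ident)
  then have "((\<lambda>\<theta>. (inverse \<theta>)\<^sup>2 + ((\<theta> - s1 K S \<theta> y) / \<theta>)\<^sup>2 * K2 (s1 K S \<theta> y))
      \<longlongrightarrow> K2 (saddlepoint K S y)) at_top"
    by simp
  moreover have "\<forall>\<^sub>F \<theta> in at_top. (inverse \<theta>)\<^sup>2 + ((\<theta> - s1 K S \<theta> y) / \<theta>)\<^sup>2 * K2 (s1 K S \<theta> y)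
      = (1 + (\<theta> - s1 K S \<theta> y)\<^sup>2 * K2 (s1 K S \<theta> y)) / \<theta>\<^sup>2"
    using eventually_gt_at_top[of 0] by eventually_elim (simp add: field_simps power_divide)
  ultimately show ?thesis
    by (rule Lim_transform_eventually)
qed

text \<open>The factor theta moves under the power -1/2 as theta^-2, where it normalises Q, and exp
  (- theta y) removes the tilt. What is left is the formula for the saddlepoint density with
  s1(theta) in place of t and Q / theta^2 in place of K2(t).\<close>

lemma Xi1_asymp:
  "((\<lambda>\<theta>. Xi1 K S \<theta> y * \<theta> * exp (- (\<theta> * y))) \<longlongrightarrow> saddlepoint_density K S y) at_top"
proof -
  let ?t = "saddlepoint K S y"
  let ?Q = "\<lambda>\<theta>. 1 + (\<theta> - s1 K S \<theta> y)\<^sup>2 * K2 (s1 K S \<theta> y)"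
  have "((\<lambda>\<theta>. K (s1 K S \<theta> y)) \<longlongrightarrow> K ?t) at_top"
    by (rule isCont_tendsto_compose[OF DERIV_isCont[OF K_deriv] tendsto_s1]) (rule saddlepoint_in)
  then have "((\<lambda>\<theta>. (2 * pi * (?Q \<theta> / \<theta>\<^sup>2)) powr (- 1 / 2) * exp (K (s1 K S \<theta> y) - s1 K S \<theta> y * y))
      \<longlongrightarrow> (2 * pi * K2 ?t) powr (- 1 / 2) * exp (K ?t - ?t * y)) at_top"
    using K2_pos[OF saddlepoint_in, of y]
    by (intro tendsto_intros tendsto_scaled_denominator tendsto_s1) auto
  moreover have "\<forall>\<^sub>F \<theta> in at_top. (2 * pi * (?Q \<theta> / \<theta>\<^sup>2)) powr (- 1 / 2)
      * exp (K (s1 K S \<theta> y) - s1 K S \<theta> y * y) = Xi1 K S \<theta> y * \<theta> * exp (- (\<theta> * y))"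
    using eventually_gt_at_top[of 0]
  proof eventually_elim
    case (elim \<theta>)
    have Q: "0 < ?Q \<theta>"
      using K2_pos[OF s1_spec(1), of \<theta> y] elim by (intro add_pos_nonneg) auto
    have "(2 * pi * (x / \<theta>\<^sup>2)) powr (- 1 / 2) = (2 * pi * x) powr (- 1 / 2) * \<theta>" if "0 < x" for x
    proof -
      have "(2 * pi * (x / \<theta>\<^sup>2)) powr (- 1 / 2) = (2 * pi * x) powr (- 1 / 2) / (\<theta>\<^sup>2) powr (- 1 / 2)"
        using powr_divide[of "2 * pi * x" "\<theta>\<^sup>2" "- 1 / 2"] that by simp
      also have "(\<theta>\<^sup>2) powr (- 1 / 2) = inverse \<theta>"
        using elim powr_minus[of "\<theta>\<^sup>2" "1 / 2"] by (simp add: powr_half_sqrt)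
      also have "(2 * pi * x) powr (- 1 / 2) / inverse \<theta> = (2 * pi * x) powr (- 1 / 2) * \<theta>"
        by (simp only: divide_inverse[of _ "inverse \<theta>"] inverse_inverse_eq)
      finally show ?thesis .
    qed
    note powr_eq = this[OF Q]
    have exp_eq: "exp (K (s1 K S \<theta> y) - s1 K S \<theta> y * y)
        = exp (K (s1 K S \<theta> y) - (s1 K S \<theta> y - \<theta>) * y) * exp (- (\<theta> * y))"
      unfolding exp_add[symmetric] by (simp add: algebra_simps)
    show ?case
      unfolding powr_eq exp_eq Xi1_eq[OF less_imp_le[OF elim]] by (simp only: mult_ac)
  qed
  ultimately show ?thesis
    unfolding saddlepoint_density_eq by (rule Lim_transform_eventually)
qed

text \<open>With q = s' = 1/Q and w = 1/u, the derivatives of s, u, w and q are polynomials in these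
  quantities and in K2, K3, K4 at s. Both derivatives of log Xi_1 are then explicit, and their
  limits reduce to counting powers of theta.\<close>

lemma log_tail_expansion_Xi1: "log_tail_expansion (\<lambda>\<theta>. ln (Xi1 K S \<theta> y)) y"
proof -
  let ?t = "saddlepoint K S y"
  define s where "s \<theta> = s1 K S \<theta> y" for \<theta>
  define u where "u \<theta> = \<theta> - s \<theta>" for \<theta>
  define w where "w \<theta> = inverse (u \<theta>)" for \<theta>
  define Q where "Q \<theta> = 1 + (u \<theta>)\<^sup>2 * K2 (s \<theta>)" for \<theta>
  define q where "q \<theta> = inverse (Q \<theta>)" for \<theta>
  define Q' where "Q' \<theta> = 2 * u \<theta> * (1 - q \<theta>) * K2 (s \<theta>) + (u \<theta>)\<^sup>2 * K3 (s \<theta>) * q \<theta>" for \<theta>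
  define q' where "q' \<theta> = - (q \<theta>)\<^sup>2 * Q' \<theta>" for \<theta>
  \<comment> \<open>\<open>K2\<close> enters only through q. The term with w q has order theta^-3
    and the term with \<open>K3\<close> is O(theta^-2), so both vanish after multiplication by
    theta.\<close>
  define L1 where "L1 \<theta> = y - w \<theta> * q \<theta> - w \<theta> * (1 - q \<theta>)\<^sup>2 - (u \<theta>)\<^sup>2 * K3 (s \<theta>) * (q \<theta>)\<^sup>2 / 2" for \<theta>
  define L2 where "L2 \<theta> = (w \<theta>)\<^sup>2 * (1 - q \<theta>) * q \<theta> - w \<theta> * q' \<theta>
      + (w \<theta>)\<^sup>2 * (1 - q \<theta>) ^ 3 + 2 * w \<theta> * (1 - q \<theta>) * q' \<theta>
      - u \<theta> * (1 - q \<theta>) * K3 (s \<theta>) * (q \<theta>)\<^sup>2 - (u \<theta>)\<^sup>2 * K4 (s \<theta>) * (q \<theta>) ^ 3 / 2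
      - (u \<theta>)\<^sup>2 * K3 (s \<theta>) * q \<theta> * q' \<theta>" for \<theta>
  have s: "s \<theta> \<in> S" "0 < u \<theta>" "K1 (s \<theta>) = y - w \<theta>" if "\<theta> > 0" for \<theta>
    using s1_spec[of \<theta> y] that by (auto simp: s_def u_def w_def inverse_eq_divide)
  have Q: "0 < Q \<theta>" if "\<theta> > 0" for \<theta>
    unfolding Q_def using K2_pos[OF s(1)[OF that]] by (intro add_pos_nonneg) auto
  have ds: "(s has_real_derivative q \<theta>) (at \<theta>)" if "\<theta> > 0" for \<theta>
    using s1_has_derivative[of \<theta> y] that unfolding s_def[abs_def] q_def Q_def u_def by simp
  have du: "(u has_real_derivative 1 - q \<theta>) (at \<theta>)" if "\<theta> > 0" for \<theta>
    unfolding u_def[abs_def] by (intro DERIV_diff DERIV_ident ds that)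
  have dw: "(w has_real_derivative - (w \<theta>)\<^sup>2 * (1 - q \<theta>)) (at \<theta>)" if "\<theta> > 0" for \<theta>
    unfolding w_def[abs_def] using s(2)[OF that]
    by (auto intro!: derivative_eq_intros du[OF that] simp: power2_eq_square)
  note dK = DERIV_chain2[where g = s]
  have dQ: "(Q has_real_derivative Q' \<theta>) (at \<theta>)" if "\<theta> > 0" for \<theta>
    unfolding Q_def[abs_def] Q'_def
    by (auto intro!: derivative_eq_intros du[OF that] dK[OF K2_deriv[OF s(1)[OF that]] ds[OF that]])
  have dq: "(q has_real_derivative q' \<theta>) (at \<theta>)" if "\<theta> > 0" for \<theta>
    unfolding q_def[abs_def] q'_def using Q[OF that]
    by (auto intro!: derivative_eq_intros dQ[OF that] simp: power2_eq_square)
  have log_eq: "ln (Xi1 K S \<theta> y) = ln (2 * pi) * (- 1 / 2) + - 1 / 2 * ln (Q \<theta>) + K (s \<theta>) - (s \<theta> - \<theta>) * y"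
    if "\<theta> > 0" for \<theta>
  proof -
    have "Xi1 K S \<theta> y = (2 * pi * Q \<theta>) powr (- 1 / 2) * exp (K (s \<theta>) - (s \<theta> - \<theta>) * y)"
      using that by (simp add: Xi1_eq s_def Q_def u_def)
    then show ?thesis
      using Q[OF that] by (simp add: ln_mult ln_powr add_divide_distrib)
  qed
  have d1: "((\<lambda>\<theta>. ln (Xi1 K S \<theta> y)) has_real_derivative L1 \<theta>) (at \<theta>)" if "\<theta> > 0" for \<theta>
  proof (rule has_field_derivative_transform_within_open)
    have "((\<lambda>\<theta>. ln (2 * pi) * (- 1 / 2) + - 1 / 2 * ln (Q \<theta>) + K (s \<theta>) - (s \<theta> - \<theta>) * y)
        has_real_derivative (- 1 / 2 * (Q' \<theta> * q \<theta>) + (y - w \<theta>) * q \<theta> - (q \<theta> - 1) * y)) (at \<theta>)"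
      by (rule DERIV_cong, (rule DERIV_diff DERIV_add DERIV_cmult DERIV_cmult_right DERIV_const DERIV_ident
            DERIV_chain2[OF DERIV_ln[OF Q[OF that]] dQ[OF that]]
            dK[OF K_deriv[OF s(1)[OF that]] ds[OF that]] ds[OF that])+)
        (simp add: s(3)[OF that] q_def)
    also have "- 1 / 2 * (Q' \<theta> * q \<theta>) + (y - w \<theta>) * q \<theta> - (q \<theta> - 1) * y = L1 \<theta>"
    proof -
      \<comment> \<open>These two relations remove \<open>K2\<close>: u K2 q = w (Q - 1) q = w (1 -
        q). This is how the decisive term w (1 - q)^2 arises from the derivative of -(1/2) ln
        Q.\<close>
      have "Q \<theta> * q \<theta> = 1" "u \<theta> * w \<theta> = 1"
        using Q[OF that] s(2)[OF that] by (auto simp: q_def w_def)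
      have "u \<theta> * K2 (s \<theta>) * q \<theta> = w \<theta> * ((u \<theta>)\<^sup>2 * K2 (s \<theta>)) * q \<theta>"
        using \<open>u \<theta> * w \<theta> = 1\<close> by (simp add: power2_eq_square mult_ac)
      also have "\<dots> = w \<theta> * (Q \<theta> * q \<theta> - q \<theta>)"
        by (simp add: Q_def algebra_simps)
      also have "\<dots> = w \<theta> * (1 - q \<theta>)"
        by (simp add: \<open>Q \<theta> * q \<theta> = 1\<close>)
      finally have "u \<theta> * K2 (s \<theta>) * q \<theta> * (1 - q \<theta>) = w \<theta> * (1 - q \<theta>)\<^sup>2"
        by (simp add: power2_eq_square)
      moreover have "- 1 / 2 * (Q' \<theta> * q \<theta>) + (y - w \<theta>) * q \<theta> - (q \<theta> - 1) * y
          = y - w \<theta> * q \<theta> - u \<theta> * K2 (s \<theta>) * q \<theta> * (1 - q \<theta>) - (u \<theta>)\<^sup>2 * K3 (s \<theta>) * (q \<theta>)\<^sup>2 / 2"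
        unfolding Q'_def by (simp add: field_simps power2_eq_square)
      ultimately show ?thesis
        by (simp only: L1_def)
    qed
    finally show "((\<lambda>\<theta>. ln (2 * pi) * (- 1 / 2) + - 1 / 2 * ln (Q \<theta>) + K (s \<theta>) - (s \<theta> - \<theta>) * y)
        has_real_derivative L1 \<theta>) (at \<theta>)" .
    show "open {0::real<..}" "\<theta> \<in> {0<..}"
      using that by auto
    show "ln (2 * pi) * (- 1 / 2) + - 1 / 2 * ln (Q x) + K (s x) - (s x - x) * y = ln (Xi1 K S x y)"
      if "x \<in> {0<..}" for x
      using that by (simp only: greaterThan_iff log_eq)
  qed
  have d2: "(L1 has_real_derivative L2 \<theta>) (at \<theta>)" if "\<theta> > 0" for \<theta>
    unfolding L1_def[abs_def]
    by (auto intro!: derivative_eq_intros du[OF that] dw[OF that] dq[OF that]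
        dK[OF K3_deriv[OF s(1)[OF that]] ds[OF that]]
        simp: L2_def power2_eq_square power3_eq_cube field_simps)
  have inv: "((\<lambda>\<theta>::real. inverse \<theta>) \<longlongrightarrow> 0) at_top"
    by (rule tendsto_inverse_0_at_top[OF filterlim_ident])
  \<comment> \<open>The scaled quantities v = u / theta, omega = w theta, p = q theta^2 and r = q'
    theta^3 all have finite limits. The formula for r is that of q' with the other three
    substituted.\<close>
  define v where "v \<theta> = u \<theta> / \<theta>" for \<theta>
  define \<omega> where "\<omega> \<theta> = w \<theta> * \<theta>" for \<theta>
  define p where "p \<theta> = q \<theta> * \<theta>\<^sup>2" for \<theta>
  define r where "r \<theta> = - (p \<theta>)\<^sup>2 * (2 * v \<theta> * (1 - q \<theta>) * K2 (s \<theta>) + (v \<theta>)\<^sup>2 * p \<theta> * K3 (s \<theta>) * inverse \<theta>)" for \<theta>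
  have lim_s: "(s \<longlongrightarrow> ?t) at_top"
    unfolding s_def[abs_def] by (rule tendsto_s1)
  have lim_K2: "((\<lambda>\<theta>. K2 (s \<theta>)) \<longlongrightarrow> K2 ?t) at_top" and lim_K3: "((\<lambda>\<theta>. K3 (s \<theta>)) \<longlongrightarrow> K3 ?t) at_top"
    by (rule isCont_tendsto_compose[OF DERIV_isCont lim_s],
        rule K2_deriv[OF saddlepoint_in] K3_deriv[OF saddlepoint_in])+
  have "isCont K4 ?t"
    using K4_cont open_S saddlepoint_in by (simp add: continuous_on_eq_continuous_at)
  then have lim_K4: "((\<lambda>\<theta>. K4 (s \<theta>)) \<longlongrightarrow> K4 ?t) at_top"
    by (rule isCont_tendsto_compose[OF _ lim_s])
  have lim_v: "(v \<longlongrightarrow> 1) at_top"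
    using tendsto_s1_gap_ratio[of y] by (simp add: v_def[abs_def] u_def s_def)
  have "((\<lambda>\<theta>. inverse (v \<theta>)) \<longlongrightarrow> 1) at_top"
    using tendsto_inverse[OF lim_v] by simp
  then have lim_\<omega>: "(\<omega> \<longlongrightarrow> 1) at_top"
    by (simp add: v_def \<omega>_def[abs_def] w_def divide_inverse mult.commute)
  have "((\<lambda>\<theta>. inverse (Q \<theta> / \<theta>\<^sup>2)) \<longlongrightarrow> inverse (K2 ?t)) at_top"
    using tendsto_scaled_denominator[of y] K2_pos[OF saddlepoint_in, of y]
    by (intro tendsto_inverse) (auto simp: Q_def u_def s_def)
  then have lim_p: "(p \<longlongrightarrow> inverse (K2 ?t)) at_top"
    by (simp add: p_def[abs_def] q_def divide_inverse mult.commute)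
  have "((\<lambda>\<theta>. p \<theta> * (inverse \<theta>)\<^sup>2) \<longlongrightarrow> 0) at_top"
    by (rule tendsto_eq_rhs[OF tendsto_mult[OF lim_p tendsto_power[OF inv]]]) simp
  moreover have "\<forall>\<^sub>F \<theta> in at_top. p \<theta> * (inverse \<theta>)\<^sup>2 = q \<theta>"
    using eventually_gt_at_top[of 0] by eventually_elim (simp add: p_def field_simps)
  ultimately have lim_q: "(q \<longlongrightarrow> 0) at_top"
    by (rule Lim_transform_eventually)
  \<comment> \<open>Only convergence of r matters, because r always occurs with a power of
    1/theta.\<close>
  obtain \<rho> where lim_r: "(r \<longlongrightarrow> \<rho>) at_top"
  proof
    show "(r \<longlongrightarrow> - (inverse (K2 ?t))\<^sup>2 * (2 * 1 * (1 - 0) * K2 ?t + 1\<^sup>2 * inverse (K2 ?t) * K3 ?t * 0)) at_top"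
      unfolding r_def[abs_def] by (intro tendsto_intros lim_p lim_v lim_q lim_K2 lim_K3 inv)
  qed
  have scaled: "q \<theta> = p \<theta> * (inverse \<theta>)\<^sup>2" "u \<theta> = v \<theta> * \<theta>" "w \<theta> = \<omega> \<theta> * inverse \<theta>"
      "q' \<theta> = r \<theta> * inverse \<theta> ^ 3" if "\<theta> > 0" for \<theta>
  proof -
    show q: "q \<theta> = p \<theta> * (inverse \<theta>)\<^sup>2" and u: "u \<theta> = v \<theta> * \<theta>" and "w \<theta> = \<omega> \<theta> * inverse \<theta>"
      using that by (auto simp: p_def v_def \<omega>_def field_simps)
    \<comment> \<open>Naming 1 - q protects it from the rewriting of q; what remains is polynomial
      in theta and its inverse, tied together by their product being 1.\<close>
    define e where "e = 1 - q \<theta>"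
    have "\<theta> * inverse \<theta> = 1"
      using that by simp
    then show "q' \<theta> = r \<theta> * inverse \<theta> ^ 3"
      unfolding q'_def Q'_def r_def e_def[symmetric] unfolding q u by algebra
  qed
  have "((\<lambda>\<theta>. - (\<omega> \<theta> * q \<theta>) - \<omega> \<theta> * (1 - q \<theta>)\<^sup>2 - (v \<theta>)\<^sup>2 * K3 (s \<theta>) * (p \<theta>)\<^sup>2 * inverse \<theta> / 2)
      \<longlongrightarrow> - (1 * 0) - 1 * (1 - 0)\<^sup>2 - 1\<^sup>2 * K3 ?t * (inverse (K2 ?t))\<^sup>2 * 0 / 2) at_top"
    by (intro tendsto_intros lim_\<omega> lim_q lim_v lim_K3 lim_p inv) simp
  then have "((\<lambda>\<theta>. - (\<omega> \<theta> * q \<theta>) - \<omega> \<theta> * (1 - q \<theta>)\<^sup>2 - (v \<theta>)\<^sup>2 * K3 (s \<theta>) * (p \<theta>)\<^sup>2 * inverse \<theta> / 2)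
      \<longlongrightarrow> -1) at_top"
    by (rule tendsto_eq_rhs) simp
  moreover have "\<forall>\<^sub>F \<theta> in at_top. - (\<omega> \<theta> * q \<theta>) - \<omega> \<theta> * (1 - q \<theta>)\<^sup>2
      - (v \<theta>)\<^sup>2 * K3 (s \<theta>) * (p \<theta>)\<^sup>2 * inverse \<theta> / 2 = \<theta> * (L1 \<theta> - y)"
    using eventually_gt_at_top[of 0]
  proof eventually_elim
    case (elim \<theta>)
    have "\<theta> * inverse \<theta> = 1"
      using elim by simp
    then have T: "\<theta> * w \<theta> = \<omega> \<theta>" "\<theta> * ((u \<theta>)\<^sup>2 * (q \<theta>)\<^sup>2) = (v \<theta>)\<^sup>2 * (p \<theta>)\<^sup>2 * inverse \<theta>"
      unfolding scaled[OF elim] by algebra+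
    have "\<theta> * (L1 \<theta> - y) = - (\<theta> * w \<theta> * q \<theta>) - \<theta> * w \<theta> * (1 - q \<theta>)\<^sup>2
        - K3 (s \<theta>) * (\<theta> * ((u \<theta>)\<^sup>2 * (q \<theta>)\<^sup>2)) / 2"
      unfolding L1_def by (simp add: algebra_simps)
    then show ?case
      unfolding T by (simp add: mult_ac)
  qed
  ultimately have l1: "((\<lambda>\<theta>. \<theta> * (L1 \<theta> - y)) \<longlongrightarrow> -1) at_top"
    by (rule Lim_transform_eventually)
  let ?F = "\<lambda>\<theta>. (\<omega> \<theta>)\<^sup>2 * (1 - q \<theta>) * q \<theta> - \<omega> \<theta> * r \<theta> * (inverse \<theta>)\<^sup>2
      + (\<omega> \<theta>)\<^sup>2 * (1 - q \<theta>) ^ 3 + 2 * \<omega> \<theta> * (1 - q \<theta>) * r \<theta> * (inverse \<theta>)\<^sup>2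
      - v \<theta> * (1 - q \<theta>) * K3 (s \<theta>) * (p \<theta>)\<^sup>2 * inverse \<theta>
      - (v \<theta>)\<^sup>2 * K4 (s \<theta>) * (p \<theta>) ^ 3 * (inverse \<theta>)\<^sup>2 / 2
      - (v \<theta>)\<^sup>2 * K3 (s \<theta>) * p \<theta> * r \<theta> * inverse \<theta>"
  let ?c = "inverse (K2 ?t)"
  \<comment> \<open>The third summand, from differentiating w in w (1 - q)^2, gives the limit 1;
    every other one contains q or a power of 1/theta.\<close>
  have "(?F \<longlongrightarrow> 1\<^sup>2 * (1 - 0) * 0 - 1 * \<rho> * 0\<^sup>2 + 1\<^sup>2 * (1 - 0) ^ 3 + 2 * 1 * (1 - 0) * \<rho> * 0\<^sup>2
      - 1 * (1 - 0) * K3 ?t * ?c\<^sup>2 * 0 - 1\<^sup>2 * K4 ?t * ?c ^ 3 * 0\<^sup>2 / 2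
      - 1\<^sup>2 * K3 ?t * ?c * \<rho> * 0) at_top"
    by (intro tendsto_intros lim_\<omega> lim_q lim_v lim_K3 lim_K4 lim_p lim_r inv) simp_all
  then have "(?F \<longlongrightarrow> 1) at_top"
    by (rule tendsto_eq_rhs) simp
  moreover have "\<forall>\<^sub>F \<theta> in at_top. ?F \<theta> = \<theta>\<^sup>2 * L2 \<theta>"
    using eventually_gt_at_top[of 0]
  proof eventually_elim
    case (elim \<theta>)
    define e where "e = 1 - q \<theta>"
    have "\<theta> * inverse \<theta> = 1"
      using elim by simp
    then have T: "\<theta>\<^sup>2 * (w \<theta>)\<^sup>2 = (\<omega> \<theta>)\<^sup>2"
      "\<theta>\<^sup>2 * (w \<theta> * q' \<theta>) = \<omega> \<theta> * r \<theta> * (inverse \<theta>)\<^sup>2"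
      "\<theta>\<^sup>2 * (u \<theta> * (q \<theta>)\<^sup>2) = v \<theta> * (p \<theta>)\<^sup>2 * inverse \<theta>"
      "\<theta>\<^sup>2 * ((u \<theta>)\<^sup>2 * (q \<theta>) ^ 3) = (v \<theta>)\<^sup>2 * (p \<theta>) ^ 3 * (inverse \<theta>)\<^sup>2"
      "\<theta>\<^sup>2 * ((u \<theta>)\<^sup>2 * q \<theta> * q' \<theta>) = (v \<theta>)\<^sup>2 * p \<theta> * r \<theta> * inverse \<theta>"
      unfolding scaled[OF elim] by algebra+
    have "\<theta>\<^sup>2 * L2 \<theta> = \<theta>\<^sup>2 * (w \<theta>)\<^sup>2 * e * q \<theta> - \<theta>\<^sup>2 * (w \<theta> * q' \<theta>)
        + \<theta>\<^sup>2 * (w \<theta>)\<^sup>2 * e ^ 3 + 2 * e * (\<theta>\<^sup>2 * (w \<theta> * q' \<theta>))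
        - e * K3 (s \<theta>) * (\<theta>\<^sup>2 * (u \<theta> * (q \<theta>)\<^sup>2)) - K4 (s \<theta>) * (\<theta>\<^sup>2 * ((u \<theta>)\<^sup>2 * (q \<theta>) ^ 3)) / 2
        - K3 (s \<theta>) * (\<theta>\<^sup>2 * ((u \<theta>)\<^sup>2 * q \<theta> * q' \<theta>))"
      unfolding L2_def e_def[symmetric] by (simp add: algebra_simps)
    then show ?case
      unfolding T e_def[symmetric] by (simp add: mult_ac)
  qed
  ultimately have l2: "((\<lambda>\<theta>. \<theta>\<^sup>2 * L2 \<theta>) \<longlongrightarrow> 1) at_top"
    by (rule Lim_transform_eventually)
  show ?thesis
    unfolding log_tail_expansion_def using d1 d2 l1 l2
    by (intro exI[of _ 0] exI[of _ L1] exI[of _ L2]) auto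
qed

lemma Mt1_expansion:
  shows "((\<lambda>\<theta>. Mt1 K S y \<theta> / (inverse \<theta> * exp (\<theta> * y) * saddlepoint_density K S y / Xi1 K S 0 y))
      \<longlongrightarrow> 1) at_top"
    and "log_tail_expansion (Kt1 K S y) y"
proof -
  let ?D = "saddlepoint_density K S y"
  note pos = Xi1_pos[of 0 y, OF order_refl] saddlepoint_density_pos[of y]
  have "((\<lambda>\<theta>. Xi1 K S \<theta> y * \<theta> * exp (- (\<theta> * y)) / ?D) \<longlongrightarrow> 1) at_top"
    by (rule tendsto_eq_rhs[OF tendsto_divide[OF Xi1_asymp tendsto_const]]) (use pos in auto)
  moreover have "\<forall>\<^sub>F \<theta> in at_top. Xi1 K S \<theta> y * \<theta> * exp (- (\<theta> * y)) / ?D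
      = Mt1 K S y \<theta> / (inverse \<theta> * exp (\<theta> * y) * ?D / Xi1 K S 0 y)"
    using eventually_gt_at_top[of 0]
    by eventually_elim (use pos in \<open>simp add: Mt1_def exp_minus field_simps\<close>)
  ultimately show "((\<lambda>\<theta>. Mt1 K S y \<theta> / (inverse \<theta> * exp (\<theta> * y) * ?D / Xi1 K S 0 y)) \<longlongrightarrow> 1) at_top"
    by (rule Lim_transform_eventually)
  show "log_tail_expansion (Kt1 K S y) y"
  proof (rule log_tail_expansion_add_const[OF log_tail_expansion_Xi1])
    show "Kt1 K S y \<theta> = ln (Xi1 K S \<theta> y) + - ln (Xi1 K S 0 y)" if "\<theta> > 0" for \<theta>
      using pos(1) Xi1_pos[of \<theta> y] that by (simp add: Kt1_def Mt1_def ln_div)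
  qed
qed

text \<open>By \<open>Xi1_asymp\<close> the ratio is asymptotic to a constant times exp (- (b - a)
  theta), which beats every power of theta. The powers of c only adapt the standard limit of x^2 /
  exp x, taken at x = c theta.\<close>

lemma Xi1_ratio_small:
  assumes "a < b"
  shows "((\<lambda>\<theta>. \<theta>\<^sup>2 * (Xi1 K S \<theta> a / Xi1 K S \<theta> b)) \<longlongrightarrow> 0) at_top"
proof -
  define c where "c = b - a"
  have c: "0 < c"
    using assms by (simp add: c_def)
  have "filterlim (\<lambda>\<theta>. c * \<theta>) at_top at_top"
    using c by (rule filterlim_tendsto_pos_mult_at_top[OF tendsto_const]) (rule filterlim_ident)
  then have "((\<lambda>\<theta>. (c * \<theta>)\<^sup>2 / exp (c * \<theta>)) \<longlongrightarrow> 0) at_top"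
    by (rule filterlim_compose[OF tendsto_power_div_exp_0])
  then have "((\<lambda>\<theta>. (Xi1 K S \<theta> a * \<theta> * exp (- (\<theta> * a))) / (Xi1 K S \<theta> b * \<theta> * exp (- (\<theta> * b)))
      * ((c * \<theta>)\<^sup>2 / exp (c * \<theta>) / c\<^sup>2))
    \<longlongrightarrow> saddlepoint_density K S a / saddlepoint_density K S b * (0 / c\<^sup>2)) at_top"
    using saddlepoint_density_pos[of b] c by (intro tendsto_intros Xi1_asymp) auto
  then have "((\<lambda>\<theta>. (Xi1 K S \<theta> a * \<theta> * exp (- (\<theta> * a))) / (Xi1 K S \<theta> b * \<theta> * exp (- (\<theta> * b)))
      * ((c * \<theta>)\<^sup>2 / exp (c * \<theta>) / c\<^sup>2)) \<longlongrightarrow> 0) at_top"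
    by (rule tendsto_eq_rhs) simp
  moreover have "\<forall>\<^sub>F \<theta> in at_top. (Xi1 K S \<theta> a * \<theta> * exp (- (\<theta> * a))) / (Xi1 K S \<theta> b * \<theta> * exp (- (\<theta> * b)))
      * ((c * \<theta>)\<^sup>2 / exp (c * \<theta>) / c\<^sup>2) = \<theta>\<^sup>2 * (Xi1 K S \<theta> a / Xi1 K S \<theta> b)"
    using eventually_gt_at_top[of 0]
  proof eventually_elim
    case (elim \<theta>)
    have e: "exp (c * \<theta>) = exp (- (\<theta> * a)) / exp (- (\<theta> * b))"
      unfolding exp_diff[symmetric] c_def by (simp add: algebra_simps)
    show ?case
      unfolding e using elim c Xi1_pos[of \<theta> b] by (simp add: field_simps)
  qed
  ultimately show ?thesis
    by (rule Lim_transform_eventually)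
qed

text \<open>The numerator is Xi_1(theta, b) (1 - R) with R the ratio just estimated: R tending to 0
  gives the first claim, and the faster decay of R together with
  \<open>log_tail_expansion_subtract_small\<close> gives the second.\<close>

lemma Mt1_ab_expansion:
  assumes "a < b" and C: "0 < Xi1 K S 0 b - Xi1 K S 0 a"
  shows "((\<lambda>\<theta>. Mt1_ab K S a b \<theta> / (inverse \<theta> * exp (\<theta> * b) * saddlepoint_density K S b
      / (Xi1 K S 0 b - Xi1 K S 0 a))) \<longlongrightarrow> 1) at_top"
    and "log_tail_expansion (Kt1_ab K S a b) b"
proof -
  let ?D = "saddlepoint_density K S b" and ?C = "Xi1 K S 0 b - Xi1 K S 0 a"
  define R where "R \<theta> = Xi1 K S \<theta> a / Xi1 K S \<theta> b" for \<theta>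
  have R2: "((\<lambda>\<theta>. \<theta>\<^sup>2 * R \<theta>) \<longlongrightarrow> 0) at_top"
    unfolding R_def by (rule Xi1_ratio_small[OF assms(1)])
  have inv: "((\<lambda>\<theta>::real. inverse \<theta>) \<longlongrightarrow> 0) at_top"
    by (rule tendsto_inverse_0_at_top[OF filterlim_ident])
  have "((\<lambda>\<theta>. \<theta>\<^sup>2 * R \<theta> * (inverse \<theta>)\<^sup>2) \<longlongrightarrow> 0) at_top"
    by (rule tendsto_eq_rhs[OF tendsto_mult[OF R2 tendsto_power[OF inv]]]) simp
  moreover have "\<forall>\<^sub>F \<theta> in at_top. \<theta>\<^sup>2 * R \<theta> * (inverse \<theta>)\<^sup>2 = R \<theta>"
    using eventually_gt_at_top[of 0] by eventually_elim (simp add: field_simps)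
  ultimately have R0: "(R \<longlongrightarrow> 0) at_top"
    by (rule Lim_transform_eventually)
  have Xi_diff: "Xi1 K S \<theta> b - Xi1 K S \<theta> a = Xi1 K S \<theta> b * (1 - R \<theta>)" if "\<theta> > 0" for \<theta>
    using Xi1_pos[of \<theta> b] that by (simp add: R_def right_diff_distrib)
  have "((\<lambda>\<theta>. Xi1 K S \<theta> b * \<theta> * exp (- (\<theta> * b)) * (1 - R \<theta>) / ?D) \<longlongrightarrow> ?D * (1 - 0) / ?D) at_top"
    using saddlepoint_density_pos[of b] by (intro tendsto_intros Xi1_asymp R0) simp
  then have "((\<lambda>\<theta>. Xi1 K S \<theta> b * \<theta> * exp (- (\<theta> * b)) * (1 - R \<theta>) / ?D) \<longlongrightarrow> 1) at_top"
    by (rule tendsto_eq_rhs) (use saddlepoint_density_pos[of b] in simp)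
  moreover have "\<forall>\<^sub>F \<theta> in at_top. Xi1 K S \<theta> b * \<theta> * exp (- (\<theta> * b)) * (1 - R \<theta>) / ?D
      = Mt1_ab K S a b \<theta> / (inverse \<theta> * exp (\<theta> * b) * ?D / ?C)"
    using eventually_gt_at_top[of 0]
  proof eventually_elim
    case (elim \<theta>)
    show ?case
      unfolding Mt1_ab_def Xi_diff[OF elim]
      using C elim saddlepoint_density_pos[of b] by (simp add: exp_minus divide_simps)
  qed
  ultimately show "((\<lambda>\<theta>. Mt1_ab K S a b \<theta> / (inverse \<theta> * exp (\<theta> * b) * ?D / ?C)) \<longlongrightarrow> 1) at_top"
    by (rule Lim_transform_eventually)
  \<comment> \<open>Beyond this threshold 1 - R is positive, so the logarithm of the numerator
    splits into a sum.\<close>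
  have "\<forall>\<^sub>F \<theta> in at_top. R \<theta> < 1"
    using R0 by (rule order_tendstoD) simp
  then obtain T where T: "\<And>\<theta>. \<theta> > T \<Longrightarrow> R \<theta> < 1"
    by (auto simp: eventually_at_top_dense)
  have R_eq: "exp (ln (Xi1 K S \<theta> a) - ln (Xi1 K S \<theta> b)) = R \<theta>" if "\<theta> > 0" for \<theta>
    using Xi1_pos[of \<theta>] that by (simp add: R_def exp_diff)
  have "((\<lambda>\<theta>. \<theta>\<^sup>2 * exp (ln (Xi1 K S \<theta> a) - ln (Xi1 K S \<theta> b))) \<longlongrightarrow> 0) at_top"
    by (rule Lim_transform_eventually[OF R2], rule eventually_mono[OF eventually_gt_at_top[of 0]])
      (simp add: R_eq)
  then have "log_tail_expansion (\<lambda>\<theta>. ln (Xi1 K S \<theta> b) + ln (1 - exp (ln (Xi1 K S \<theta> a) - ln (Xi1 K S \<theta> b)))) b"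
    by (rule log_tail_expansion_subtract_small[OF log_tail_expansion_Xi1 log_tail_expansion_Xi1])
  then show "log_tail_expansion (Kt1_ab K S a b) b"
  proof (rule log_tail_expansion_add_const)
    show "Kt1_ab K S a b \<theta> = ln (Xi1 K S \<theta> b) + ln (1 - exp (ln (Xi1 K S \<theta> a) - ln (Xi1 K S \<theta> b))) + - ln ?C"
      if "\<theta> > max 0 T" for \<theta>
    proof -
      have "\<theta> > 0" "0 < 1 - R \<theta>"
        using that T[of \<theta>] by auto
      then show ?thesis
        using Xi1_pos[of \<theta> b] C by (simp add: Kt1_ab_def Mt1_ab_def Xi_diff R_eq ln_mult ln_div)
    qed
  qed
qed

section \<open>Reflection\<close>

text \<open>The function K(-t) is the cumulant generating function of -X, so the strip is reflected
  and the derivatives of odd order change sign.\<close>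

lemma steep_cgf_reflect:
  "steep_cgf (\<lambda>t. K (- t)) (\<lambda>t. - K1 (- t)) (\<lambda>t. K2 (- t)) (\<lambda>t. - K3 (- t)) (\<lambda>t. K4 (- t)) (uminus ` S)"
proof
  have mirror: "((\<lambda>x. f (- x)) has_real_derivative - f' (- t)) (at t)"
    if "t \<in> uminus ` S" "\<And>t. t \<in> S \<Longrightarrow> (f has_real_derivative f' t) (at t)" for t f f'
    using that(1) that(2)[of "- t"] by (auto simp: DERIV_mirror)
  show "((\<lambda>t. K (- t)) has_real_derivative - K1 (- t)) (at t)" if "t \<in> uminus ` S" for t
    using mirror[OF that K_deriv] .
  show "((\<lambda>t. - K1 (- t)) has_real_derivative K2 (- t)) (at t)" if "t \<in> uminus ` S" for t
    using DERIV_minus[OF mirror[OF that K1_deriv]] by simp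
  show "((\<lambda>t. K2 (- t)) has_real_derivative - K3 (- t)) (at t)" if "t \<in> uminus ` S" for t
    using mirror[OF that K2_deriv] .
  show "((\<lambda>t. - K3 (- t)) has_real_derivative K4 (- t)) (at t)" if "t \<in> uminus ` S" for t
    using DERIV_minus[OF mirror[OF that K3_deriv]] by simp
  show "open (uminus ` S)"
    using open_S by (rule open_negations)
  show "is_interval (uminus ` S)"
    using interval_S by simp
  show "0 \<in> uminus ` S"
    using zero_S by force
  show "continuous_on (uminus ` S) (\<lambda>t. K4 (- t))"
    by (rule continuous_on_compose2[OF K4_cont]) (auto intro: continuous_intros)
  show "0 < K2 (- t)" if "t \<in> uminus ` S" for t
    using that K2_pos by auto
  show "\<exists>t\<in>uminus ` S. - K1 (- t) = y" for y
    using K1_onto[of "- y"] by force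
qed

text \<open>Reflection negates the saddlepoint and leaves both the variance term and the product of
  saddlepoint and argument unchanged.\<close>

lemma saddlepoint_density_reflect:
  "saddlepoint_density (\<lambda>t. K (- t)) (uminus ` S) (- y) = saddlepoint_density K S y"
proof -
  interpret R: steep_cgf "\<lambda>t. K (- t)" "\<lambda>t. - K1 (- t)" "\<lambda>t. K2 (- t)" "\<lambda>t. - K3 (- t)"
    "\<lambda>t. K4 (- t)" "uminus ` S"
    by (rule steep_cgf_reflect)
  have "saddlepoint (\<lambda>t. K (- t)) (uminus ` S) (- y) = - saddlepoint K S y"
    by (rule R.saddlepoint_eqI) (simp_all add: saddlepoint_in)
  then show ?thesis
    by (simp add: R.saddlepoint_density_eq saddlepoint_density_eq)
qed

text \<open>The substitution x -> -x turns the upper tail integral from y with tilt -theta into the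
  lower tail integral to -y with tilt theta. For the approximations this holds exactly, because the
  two saddlepoint equations are negatives of each other.\<close>

lemma Xi2_reflect:
  assumes "0 \<le> \<theta>"
  shows "Xi2 K S (- \<theta>) y = Xi1 (\<lambda>t. K (- t)) (uminus ` S) \<theta> (- y)"
proof -
  interpret R: steep_cgf "\<lambda>t. K (- t)" "\<lambda>t. - K1 (- t)" "\<lambda>t. K2 (- t)" "\<lambda>t. - K3 (- t)"
    "\<lambda>t. K4 (- t)" "uminus ` S"
    by (rule steep_cgf_reflect)
  define s where "s = s1 (\<lambda>t. K (- t)) (uminus ` S) \<theta> (- y)"
  note s = R.s1_spec[OF assms, of "- y", folded s_def]
  have "- s \<in> S"
    using s(1) by auto
  have flip: "1 / (- \<theta> - r) = - (1 / (\<theta> + r))" for r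
    using minus_divide_right[of 1 "\<theta> + r"] by simp
  have "s2 K S (- \<theta>) y = - s"
    unfolding s2_def
  \<comment> \<open>Uniqueness is inherited: a root of the equation for \<open>s2\<close>, negated,
    is a root of the reflected equation for \<open>s1\<close>.\<close>
  proof (rule the_equality)
    show "- s \<in> S \<and> - s > - \<theta> \<and> deriv K (- s) + 1 / (- \<theta> - - s) = y"
      using s \<open>- s \<in> S\<close> flip[of "- s"] by (simp add: deriv_K)
    show "r = - s" if "r \<in> S \<and> r > - \<theta> \<and> deriv K r + 1 / (- \<theta> - r) = y" for r
    proof -
      have "s1 (\<lambda>t. K (- t)) (uminus ` S) \<theta> (- y) = - r"
        using that flip[of r] by (intro R.s1_eqI) (auto simp: deriv_K)
      then show ?thesis
        by (simp add: s_def)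
    qed
  qed
  moreover have "(- \<theta> - - s)\<^sup>2 = (\<theta> - s)\<^sup>2"
    by (simp add: power2_commute)
  ultimately show ?thesis
    using \<open>- s \<in> S\<close> s(1)
    by (simp add: Xi2_def Xi1_def Xi_at_def s_def[symmetric] deriv2_K R.deriv2_K algebra_simps)
qed

lemma Mt2_expansion:
  shows "((\<lambda>\<theta>. Mt2 K S y \<theta> / (inverse \<bar>\<theta>\<bar> * exp (\<theta> * y) * saddlepoint_density K S y / Xi2 K S 0 y))
      \<longlongrightarrow> 1) at_bot"
    and "log_tail_expansion (\<lambda>\<theta>. Kt2 K S y (- \<theta>)) (- y)"
proof -
  let ?K = "\<lambda>t. K (- t)" and ?S = "uminus ` S"
  interpret R: steep_cgf ?K "\<lambda>t. - K1 (- t)" "\<lambda>t. K2 (- t)" "\<lambda>t. - K3 (- t)" "\<lambda>t. K4 (- t)" ?S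
    by (rule steep_cgf_reflect)
  have Xi_0: "Xi2 K S 0 y = Xi1 ?K ?S 0 (- y)"
    using Xi2_reflect[of 0 y] by simp
  have Mt: "Mt2 K S y (- \<theta>) = Mt1 ?K ?S (- y) \<theta>" if "\<theta> > 0" for \<theta>
    using that by (simp add: Mt2_def Mt1_def Xi2_reflect Xi_0)
  show "((\<lambda>\<theta>. Mt2 K S y \<theta> / (inverse \<bar>\<theta>\<bar> * exp (\<theta> * y) * saddlepoint_density K S y / Xi2 K S 0 y))
      \<longlongrightarrow> 1) at_bot"
    unfolding filterlim_at_bot_mirror
    by (rule Lim_transform_eventually[OF R.Mt1_expansion(1)[of "- y"]],
        rule eventually_mono[OF eventually_gt_at_top[of 0]])
      (simp add: Mt Xi_0 saddlepoint_density_reflect)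
  show "log_tail_expansion (\<lambda>\<theta>. Kt2 K S y (- \<theta>)) (- y)"
    by (rule log_tail_expansion_add_const[OF R.Mt1_expansion(2)[of "- y"], where T' = 0 and c = 0])
      (simp add: Kt2_def Kt1_def Mt)
qed

text \<open>Reflection maps (a, b) to (-b, -a), so the lower endpoint a becomes the upper endpoint
  -a, which dominates.\<close>

lemma Mt2_ab_expansion:
  assumes "a < b" and C: "0 < Xi2 K S 0 a - Xi2 K S 0 b"
  shows "((\<lambda>\<theta>. Mt2_ab K S a b \<theta> / (inverse \<bar>\<theta>\<bar> * exp (\<theta> * a) * saddlepoint_density K S a
      / (Xi2 K S 0 a - Xi2 K S 0 b))) \<longlongrightarrow> 1) at_bot"
    and "log_tail_expansion (\<lambda>\<theta>. Kt2_ab K S a b (- \<theta>)) (- a)"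
proof -
  let ?K = "\<lambda>t. K (- t)" and ?S = "uminus ` S"
  interpret R: steep_cgf ?K "\<lambda>t. - K1 (- t)" "\<lambda>t. K2 (- t)" "\<lambda>t. - K3 (- t)" "\<lambda>t. K4 (- t)" ?S
    by (rule steep_cgf_reflect)
  have Xi_0: "Xi2 K S 0 x = Xi1 ?K ?S 0 (- x)" for x
    using Xi2_reflect[of 0 x] by simp
  have Mt: "Mt2_ab K S a b (- \<theta>) = Mt1_ab ?K ?S (- b) (- a) \<theta>" if "\<theta> > 0" for \<theta>
    using that by (simp add: Mt2_ab_def Mt1_ab_def Xi2_reflect Xi_0)
  have "- b < - a" "0 < Xi1 ?K ?S 0 (- a) - Xi1 ?K ?S 0 (- b)"
    using assms by (auto simp: Xi_0)
  note expansion = R.Mt1_ab_expansion[OF this]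
  show "((\<lambda>\<theta>. Mt2_ab K S a b \<theta> / (inverse \<bar>\<theta>\<bar> * exp (\<theta> * a) * saddlepoint_density K S a
      / (Xi2 K S 0 a - Xi2 K S 0 b))) \<longlongrightarrow> 1) at_bot"
    unfolding filterlim_at_bot_mirror
    by (rule Lim_transform_eventually[OF expansion(1)],
        rule eventually_mono[OF eventually_gt_at_top[of 0]])
      (simp add: Mt Xi_0 saddlepoint_density_reflect)
  show "log_tail_expansion (\<lambda>\<theta>. Kt2_ab K S a b (- \<theta>)) (- a)"
    by (rule log_tail_expansion_add_const[OF expansion(2), where T' = 0 and c = 0])
      (simp add: Kt2_ab_def Kt1_ab_def Mt)
qed

end

section \<open>Steepness from the endpoint condition\<close>

text \<open>The second inequality is positivity of the variance under the tilted law. Zero variance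
  would make X almost surely constant, which a density with respect to Lebesgue measure
  excludes.\<close>

lemma tilted_moment_variance_pos:
  fixes M :: "'a measure" and X :: "'a \<Rightarrow> real" and f0 :: "real \<Rightarrow> real"
  assumes X: "distributed M lborel X (\<lambda>x. ennreal (f0 x))" and "prob_space M"
    and int: "\<And>n. integrable M (\<lambda>\<omega>. X \<omega> ^ n * exp (\<theta> * X \<omega>))"
  shows "0 < tilted_moment M X 0 \<theta>"
    and "(tilted_moment M X 1 \<theta> / tilted_moment M X 0 \<theta>)\<^sup>2
      < tilted_moment M X 2 \<theta> / tilted_moment M X 0 \<theta>"
proof -
  interpret prob_space M by fact
  let ?m = "\<lambda>n. tilted_moment M X n \<theta>"
  have Xm [measurable]: "X \<in> borel_measurable M"
    using distributed_measurable[OF X] by simp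
  have "?m 0 \<noteq> 0"
  proof
    assume "?m 0 = 0"
    then have "AE \<omega> in M. exp (\<theta> * X \<omega>) = 0"
      using int[of 0] by (simp add: tilted_moment_def integral_nonneg_eq_0_iff_AE)
    then show False
      by simp
  qed
  moreover have "0 \<le> ?m 0"
    by (simp add: tilted_moment_def)
  ultimately show m0: "0 < ?m 0"
    by simp
  define c where "c = ?m 1 / ?m 0"
  let ?g = "\<lambda>\<omega>. (X \<omega> - c)\<^sup>2 * exp (\<theta> * X \<omega>)"
  have g_eq: "?g = (\<lambda>\<omega>. X \<omega> ^ 2 * exp (\<theta> * X \<omega>) - 2 * c * (X \<omega> ^ 1 * exp (\<theta> * X \<omega>))
      + c\<^sup>2 * (X \<omega> ^ 0 * exp (\<theta> * X \<omega>)))"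
    by (simp add: fun_eq_iff power2_eq_square algebra_simps)
  have g_int: "integrable M ?g"
    unfolding g_eq using int[of 2] int[of 1] int[of 0]
    by (intro Bochner_Integration.integrable_add Bochner_Integration.integrable_diff integrable_mult_right)
  have g_val: "integral\<^sup>L M ?g = ?m 2 - 2 * c * ?m 1 + c\<^sup>2 * ?m 0"
    unfolding g_eq tilted_moment_def
    by (simp only: Bochner_Integration.integral_add Bochner_Integration.integral_diff
        Bochner_Integration.integrable_diff integral_mult_right_zero integrable_mult_right int)
  have "integral\<^sup>L M ?g \<noteq> 0"
  proof
    assume "integral\<^sup>L M ?g = 0"
    then have "AE \<omega> in M. X \<omega> = c"
      using g_int by (subst (asm) integral_nonneg_eq_0_iff_AE) auto
    then have "emeasure M (X -` {c} \<inter> space M) = emeasure M (space M)"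
      by (intro emeasure_eq_AE) auto
    moreover have "emeasure M (X -` {c} \<inter> space M) = (\<integral>\<^sup>+ x. ennreal (f0 x) * indicator {c} x \<partial>lborel)"
      by (rule distributed_emeasure[OF X]) simp
    \<comment> \<open>A singleton is Lebesgue null, so X = c has probability 0, contrary to the
      total mass 1.\<close>
    moreover have "AE x in lborel. ennreal (f0 x) * indicator {c} x = 0"
      using AE_lborel_singleton[of c] by eventually_elim (simp add: indicator_def)
    then have "(\<integral>\<^sup>+ x. ennreal (f0 x) * indicator {c} x \<partial>lborel) = 0"
      by (subst nn_integral_cong_AE[where v = "\<lambda>_. 0"]) auto
    ultimately show False
      using emeasure_space_1 by simp
  qed
  moreover have "0 \<le> integral\<^sup>L M ?g"
    by simp
  ultimately have "0 < ?m 2 - 2 * c * ?m 1 + c\<^sup>2 * ?m 0"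
    by (simp only: g_val)
  also have "\<dots> = ?m 0 * (?m 2 / ?m 0 - c\<^sup>2)"
    using m0 by (simp add: c_def field_simps power2_eq_square)
  finally show "(?m 1 / ?m 0)\<^sup>2 < ?m 2 / ?m 0"
    using m0 by (simp add: c_def zero_less_mult_iff)
qed

text \<open>The hypotheses control only |f| at the endpoints; monotonicity supplies the signs, since
  f lies below f 0 left of 0 and above it on the right. The limits are taken in the extended reals
  so that finite and infinite endpoints are treated alike.\<close>

lemma steep_derivative_onto:
  fixes f f' :: "real \<Rightarrow> real" and \<alpha> \<beta> :: ereal
  assumes "0 < \<alpha>" "0 < \<beta>" and S: "S = einterval (- \<alpha>) \<beta>"
    and f: "\<And>t. t \<in> S \<Longrightarrow> (f has_real_derivative f' t) (at t)"
    and mono: "\<And>t. t \<in> S \<Longrightarrow> 0 < f' t"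
    and left: "filterlim ((\<lambda>t. \<bar>f t\<bar>) \<circ> real_of_ereal) at_top (at_right (- \<alpha>))"
    and right: "filterlim ((\<lambda>t. \<bar>f t\<bar>) \<circ> real_of_ereal) at_top (at_left \<beta>)"
  shows "\<exists>t\<in>S. f t = y"
proof -
  have S_iff: "t \<in> S \<longleftrightarrow> - \<alpha> < ereal t \<and> ereal t < \<beta>" for t
    by (simp add: S einterval_def)
  have "- \<alpha> < 0"
    using assms(1) by (simp add: ereal_uminus_less_reorder)
  have zero: "0 \<in> S"
    using \<open>- \<alpha> < 0\<close> assms(2) by (simp add: S_iff zero_ereal_def)
  have between: "x \<in> S" if "s \<in> S" "t \<in> S" "s \<le> x" "x \<le> t" for s t x
    using that less_le_trans[of "- \<alpha>" "ereal s" "ereal x"] le_less_trans[of "ereal x" "ereal t" \<beta>]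
    by (simp add: S_iff)
  have incr: "f s < f t" if "s \<in> S" "t \<in> S" "s < t" for s t
  proof (rule DERIV_pos_imp_increasing[OF that(3)])
    fix x
    assume "s \<le> x" "x \<le> t"
    then have "x \<in> S"
      by (rule between[OF that(1,2)])
    then show "\<exists>d. (f has_real_derivative d) (at x) \<and> 0 < d"
      using f mono by blast
  qed
  \<comment> \<open>If |f x| is at least this large while f x < f 0, then f x cannot be positive and
    so lies below -|y|; symmetrically on the right.\<close>
  let ?c = "\<bar>f 0\<bar> + \<bar>y\<bar> + 1"
  obtain l where l: "l \<in> S" "f l \<le> y"
  proof -
    have "\<forall>\<^sub>F x in at_right (- \<alpha>). ?c \<le> \<bar>f (real_of_ereal x)\<bar>"
      using left by (auto simp: filterlim_at_top)
    then obtain b where b: "- \<alpha> < b" "\<And>x. - \<alpha> < x \<Longrightarrow> x < b \<Longrightarrow> ?c \<le> \<bar>f (real_of_ereal x)\<bar>"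
      using \<open>- \<alpha> < 0\<close> by (auto simp: eventually_at_right)
    obtain x where x: "- \<alpha> < ereal x" "ereal x < min b 0"
      using ereal_dense2[of "- \<alpha>" "min b 0"] b(1) \<open>- \<alpha> < 0\<close> by auto
    have "x < 0"
      using x by (simp add: zero_ereal_def)
    have "ereal x < \<beta>"
      using x(2) assms(2) less_trans[of "ereal x" 0 \<beta>] by simp
    then have "x \<in> S"
      using x by (simp add: S_iff)
    have "f x \<le> y"
      using b(2)[OF x(1)] x(2) incr[OF \<open>x \<in> S\<close> zero \<open>x < 0\<close>] by auto
    with \<open>x \<in> S\<close> show ?thesis
      by (rule that)
  qed
  obtain r where r: "r \<in> S" "y \<le> f r"
  proof -
    have "\<forall>\<^sub>F x in at_left \<beta>. ?c \<le> \<bar>f (real_of_ereal x)\<bar>"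
      using right by (auto simp: filterlim_at_top)
    then obtain b where b: "b < \<beta>" "\<And>x. b < x \<Longrightarrow> x < \<beta> \<Longrightarrow> ?c \<le> \<bar>f (real_of_ereal x)\<bar>"
      using assms(2) by (auto simp: eventually_at_left)
    obtain x where x: "max b 0 < ereal x" "ereal x < \<beta>"
      using ereal_dense2[of "max b 0" \<beta>] b(1) assms(2) by auto
    have "0 < x"
      using x by (simp add: zero_ereal_def)
    have "- \<alpha> < ereal x"
      using x(1) \<open>- \<alpha> < 0\<close> by (auto intro: less_trans)
    then have "x \<in> S"
      using x by (simp add: S_iff)
    have "y \<le> f x"
      using b(2)[OF _ x(2)] x(1) incr[OF zero \<open>x \<in> S\<close> \<open>0 < x\<close>] by auto
    with \<open>x \<in> S\<close> show ?thesis
      by (rule that)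
  qed
  show ?thesis
  proof (cases "l \<le> r")
    case True
    have "isCont f x" if "x \<in> {l..r}" for x
      using that by (intro DERIV_isCont[OF f] between[OF l(1) r(1)]) auto
    then have "continuous_on {l..r} f"
      by (simp add: continuous_at_imp_continuous_on)
    with l(2) r(2) True obtain x where "l \<le> x" "x \<le> r" "f x = y"
      using IVT'[of f l y r] by blast
    then show ?thesis
      using between[OF l(1) r(1), of x] by blast
  next
    case False
    then have "f r < f l"
      using incr l r by simp
    then show ?thesis
      using l r by linarith
  qed
qed

text \<open>The ratios \<open>r n\<close> are the raw moments of the tilted law. The quotient rule
  gives r_n' = r_(n+1) - r_n r_1, so repeated differentiation of r_1 stays polynomial in raw
  moments.\<close>

lemma cgf_steep:
  fixes M :: "'a measure" and X :: "'a \<Rightarrow> real" and f0 :: "real \<Rightarrow> real"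
  assumes prob: "prob_space M"
    and density: "distributed M lborel X (\<lambda>x. ennreal (f0 x))"
    and alpha: "0 < \<alpha>" and beta: "0 < \<beta>"
    and S: "S = einterval (-\<alpha>) \<beta>"
    and strip: "convergence_strip M X \<alpha> \<beta>"
    and A1_left: "filterlim ((\<lambda>t. \<bar>deriv (cgf M X) t\<bar>) \<circ> real_of_ereal) at_top (at_right (-\<alpha>))"
    and A1_right: "filterlim ((\<lambda>t. \<bar>deriv (cgf M X) t\<bar>) \<circ> real_of_ereal) at_top (at_left \<beta>)"
  obtains K1 K2 K3 K4 where "steep_cgf (cgf M X) K1 K2 K3 K4 S"
proof -
  define r where "r n \<theta> = tilted_moment M X n \<theta> / tilted_moment M X 0 \<theta>" for n \<theta>
  have X: "X \<in> borel_measurable M"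
    using distributed_measurable[OF density] by simp
  have open_S: "open S"
    by (simp add: S open_einterval)
  have exp_int: "integrable M (\<lambda>\<omega>. exp (\<theta> * X \<omega>))" if "\<theta> \<in> S" for \<theta>
    using strip interior_subset that unfolding convergence_strip_def S by blast
  note int = tilted_moment_integrable[OF X open_S exp_int]
  note dm = tilted_moment_has_derivative[OF X open_S exp_int]
  have m0: "0 < tilted_moment M X 0 \<theta>" if "\<theta> \<in> S" for \<theta>
    by (rule tilted_moment_variance_pos(1)[OF density prob int]) (use that in auto)
  have var: "(r 1 \<theta>)\<^sup>2 < r 2 \<theta>" if "\<theta> \<in> S" for \<theta>
    unfolding r_def by (rule tilted_moment_variance_pos(2)[OF density prob int]) (use that in auto)
  have dr: "(r n has_real_derivative r (Suc n) \<theta> - r n \<theta> * r 1 \<theta>) (at \<theta>)" if "\<theta> \<in> S" for n \<theta>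
    unfolding r_def[abs_def] One_nat_def
    by (rule DERIV_cong[OF DERIV_divide[OF dm[OF _ that] dm[OF _ that]]])
      (use m0[OF that] in \<open>auto simp: divide_simps\<close>)
  have dcgf: "(cgf M X has_real_derivative r 1 \<theta>) (at \<theta>)" if "\<theta> \<in> S" for \<theta>
  proof -
    have "cgf M X = (\<lambda>\<theta>. ln (tilted_moment M X 0 \<theta>))"
      by (simp add: fun_eq_iff cgf_def mgf_def tilted_moment_def)
    then show ?thesis
      using DERIV_chain2[OF DERIV_ln[OF m0[OF that]] dm[of \<theta> 0]] that
      by (simp add: r_def divide_inverse mult.commute)
  qed
  define K2 where "K2 \<theta> = r 2 \<theta> - r 1 \<theta> * r 1 \<theta>" for \<theta>
  \<comment> \<open>\<open>K3\<close> and \<open>K4\<close> are the third and fourth cumulants of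
    the tilted law in terms of raw moments.\<close>
  define K3 where "K3 \<theta> = r 3 \<theta> - 3 * (r 1 \<theta> * r 2 \<theta>) + 2 * (r 1 \<theta> * (r 1 \<theta> * r 1 \<theta>))" for \<theta>
  define K4 where "K4 \<theta> = r 4 \<theta> - 4 * r 1 \<theta> * r 3 \<theta> - 3 * (r 2 \<theta>)\<^sup>2
      + 12 * (r 1 \<theta>)\<^sup>2 * r 2 \<theta> - 6 * r 1 \<theta> ^ 4" for \<theta>
  have dr1: "(r 1 has_real_derivative r 2 \<theta> - r 1 \<theta> * r 1 \<theta>) (at \<theta>)"
    and dr2: "(r 2 has_real_derivative r 3 \<theta> - r 2 \<theta> * r 1 \<theta>) (at \<theta>)"
    and dr3: "(r 3 has_real_derivative r 4 \<theta> - r 3 \<theta> * r 1 \<theta>) (at \<theta>)" if "\<theta> \<in> S" for \<theta>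
    using dr[OF that, of 1] dr[OF that, of 2] dr[OF that, of 3] by (simp_all add: eval_nat_numeral)
  have "continuous_on S (r n)" for n
    using dr by (meson DERIV_isCont continuous_at_imp_continuous_on)
  then have K4_cont: "continuous_on S K4"
    unfolding K4_def[abs_def] by (intro continuous_intros)
  have deriv_eq: "deriv (cgf M X) t = r 1 t" if "t \<in> S" for t
    by (rule DERIV_imp_deriv[OF dcgf[OF that]])
  have dK1: "(r 1 has_real_derivative K2 t) (at t)" if "t \<in> S" for t
    unfolding K2_def by (rule dr1[OF that])
  \<comment> \<open>The endpoint conditions concern \<open>deriv (cgf M X)\<close>, so surjectivity
    is proved for that function and then transferred to \<open>r 1\<close>, with which it agrees on
    S.\<close>
  have dK1': "(deriv (cgf M X) has_real_derivative K2 t) (at t)" if "t \<in> S" for t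
    by (rule has_field_derivative_transform_within_open[OF dK1 open_S]) (use that deriv_eq in auto)
  have K2_pos: "0 < K2 t" if "t \<in> S" for t
    using var[OF that] by (simp add: K2_def power2_eq_square)
  show ?thesis
  proof (rule that, unfold_locales)
    show "open S" by fact
    show "is_interval S"
      unfolding is_interval_1
    proof (intro ballI allI impI)
      fix s t x
      assume "s \<in> S" "t \<in> S" "s \<le> x \<and> x \<le> t"
      then show "x \<in> S"
        using less_le_trans[of "- \<alpha>" "ereal s" "ereal x"] le_less_trans[of "ereal x" "ereal t" \<beta>]
        by (simp add: S einterval_iff)
    qed
    show "0 \<in> S"
      using alpha beta by (simp add: S einterval_iff zero_ereal_def[symmetric] ereal_uminus_less_reorder)
    show "(cgf M X has_real_derivative r 1 t) (at t)" if "t \<in> S" for t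
      by (rule dcgf[OF that])
    show "(r 1 has_real_derivative K2 t) (at t)" if "t \<in> S" for t
      by (rule dK1[OF that])
    show "(K2 has_real_derivative K3 t) (at t)" if "t \<in> S" for t
      unfolding K2_def[abs_def]
      by (rule DERIV_cong, (rule DERIV_diff DERIV_mult dr1[OF that] dr2[OF that])+, unfold K3_def) algebra
    show "(K3 has_real_derivative K4 t) (at t)" if "t \<in> S" for t
      unfolding K3_def[abs_def]
      by (rule DERIV_cong, (rule DERIV_add DERIV_diff DERIV_cmult DERIV_mult dr1[OF that] dr2[OF that]
          dr3[OF that])+, unfold K4_def) algebra
    show "continuous_on S K4" by fact
    show "0 < K2 t" if "t \<in> S" for t
      by (rule K2_pos[OF that])
    show "\<exists>t\<in>S. r 1 t = y" for y
    proof -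
      obtain t where "t \<in> S" "deriv (cgf M X) t = y"
        using steep_derivative_onto[OF alpha beta S dK1' K2_pos A1_left A1_right] by blast
      then show ?thesis
        using deriv_eq by auto
    qed
  qed
qed

theorem theorem4p2:
  fixes M :: "'a measure" and X :: "'a \<Rightarrow> real" and f0 :: "real \<Rightarrow> real"
    and K0 :: "real \<Rightarrow> real" and \<alpha> \<beta> :: ereal and S :: "real set" and y a b :: real
  assumes prob: "prob_space M"
    and density_nonneg: "\<And>x. 0 \<le> f0 x"
    and density: "distributed M lborel X (\<lambda>x. ennreal (f0 x))"
    and K0: "K0 = cgf M X"
    and alpha: "0 < \<alpha>" and beta: "0 < \<beta>"
    and S: "S = einterval (-\<alpha>) \<beta>"
    and strip: "convergence_strip M X \<alpha> \<beta>"
    and A1_left: "filterlim ((\<lambda>t. \<bar>deriv K0 t\<bar>) \<circ> real_of_ereal) at_top (at_right (-\<alpha>))"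
    and A1_right: "filterlim ((\<lambda>t. \<bar>deriv K0 t\<bar>) \<circ> real_of_ereal) at_top (at_left \<beta>)"
    and ab: "a < b"
    and prob_ab: "measure M {\<omega> \<in> space M. a < X \<omega> \<and> X \<omega> < b} > 0"
  shows
    "((\<exists>l. (f0 \<longlongrightarrow> l) (at_left y)) \<longrightarrow>
        ((\<lambda>\<theta>. Mt1 K0 S y \<theta> /
            (inverse \<theta> * exp (\<theta> * y) * Lim (at_left y) (saddlepoint_density K0 S) / Xi1 K0 S 0 y))
          \<longlongrightarrow> 1) at_top
        \<and> eventually_twice_differentiable (Kt1 K0 S y) at_top
        \<and> (\<lambda>\<theta>. deriv (Kt1 K0 S y) \<theta> - (y - inverse \<theta>)) \<in> o[at_top](\<lambda>\<theta>. inverse \<theta>)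
        \<and> ((\<lambda>\<theta>. deriv (deriv (Kt1 K0 S y)) \<theta> / inverse (\<theta>\<^sup>2)) \<longlongrightarrow> 1) at_top)
   \<and> ((\<exists>l. (f0 \<longlongrightarrow> l) (at_right y)) \<longrightarrow>
        ((\<lambda>\<theta>. Mt2 K0 S y \<theta> /
            (inverse \<bar>\<theta>\<bar> * exp (\<theta> * y) * Lim (at_right y) (saddlepoint_density K0 S) / Xi2 K0 S 0 y))
          \<longlongrightarrow> 1) at_bot
        \<and> eventually_twice_differentiable (Kt2 K0 S y) at_bot
        \<and> (\<lambda>\<theta>. deriv (Kt2 K0 S y) \<theta> - (y - inverse \<theta>)) \<in> o[at_bot](\<lambda>\<theta>. inverse \<theta>)
        \<and> ((\<lambda>\<theta>. deriv (deriv (Kt2 K0 S y)) \<theta> / inverse (\<theta>\<^sup>2)) \<longlongrightarrow> 1) at_bot)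
   \<and> ((\<exists>l. (f0 \<longlongrightarrow> l) (at_right a)) \<and> (\<exists>l. (f0 \<longlongrightarrow> l) (at_left b))
        \<and> Xi1 K0 S 0 b - Xi1 K0 S 0 a > 0 \<longrightarrow>
        ((\<lambda>\<theta>. Mt1_ab K0 S a b \<theta> /
            (inverse \<theta> * exp (\<theta> * b) * Lim (at_left b) (saddlepoint_density K0 S)
              / (Xi1 K0 S 0 b - Xi1 K0 S 0 a)))
          \<longlongrightarrow> 1) at_top
        \<and> eventually_twice_differentiable (Kt1_ab K0 S a b) at_top
        \<and> (\<lambda>\<theta>. deriv (Kt1_ab K0 S a b) \<theta> - (b - inverse \<theta>)) \<in> o[at_top](\<lambda>\<theta>. inverse \<theta>)
        \<and> ((\<lambda>\<theta>. deriv (deriv (Kt1_ab K0 S a b)) \<theta> / inverse (\<theta>\<^sup>2)) \<longlongrightarrow> 1) at_top)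
   \<and> ((\<exists>l. (f0 \<longlongrightarrow> l) (at_right a)) \<and> (\<exists>l. (f0 \<longlongrightarrow> l) (at_left b))
        \<and> Xi2 K0 S 0 a - Xi2 K0 S 0 b > 0 \<longrightarrow>
        ((\<lambda>\<theta>. Mt2_ab K0 S a b \<theta> /
            (inverse \<bar>\<theta>\<bar> * exp (\<theta> * a) * Lim (at_right a) (saddlepoint_density K0 S)
              / (Xi2 K0 S 0 a - Xi2 K0 S 0 b)))
          \<longlongrightarrow> 1) at_bot
        \<and> eventually_twice_differentiable (Kt2_ab K0 S a b) at_bot
        \<and> (\<lambda>\<theta>. deriv (Kt2_ab K0 S a b) \<theta> - (a - inverse \<theta>)) \<in> o[at_bot](\<lambda>\<theta>. inverse \<theta>)
        \<and> ((\<lambda>\<theta>. deriv (deriv (Kt2_ab K0 S a b)) \<theta> / inverse (\<theta>\<^sup>2)) \<longlongrightarrow> 1) at_bot)"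
proof -
  obtain K1 K2 K3 K4 where "steep_cgf K0 K1 K2 K3 K4 S"
    using cgf_steep[OF prob density alpha beta S strip] A1_left A1_right unfolding K0 by blast
  then interpret steep_cgf K0 K1 K2 K3 K4 S .
  note expansions = Mt1_expansion(1) log_tail_expansion_at_top[OF Mt1_expansion(2)]
    Mt2_expansion(1) log_tail_expansion_at_bot[OF Mt2_expansion(2)]
    Mt1_ab_expansion(1)[OF ab] log_tail_expansion_at_top[OF Mt1_ab_expansion(2)[OF ab]]
    Mt2_ab_expansion(1)[OF ab] log_tail_expansion_at_bot[OF Mt2_ab_expansion(2)[OF ab]]
  show ?thesis
    \<comment> \<open>The one-sided limits become values of the saddlepoint density, the form in
      which the expansions are stated.\<close>
    unfolding Lim_saddlepoint_density
    by (intro conjI impI expansions) auto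
qed

end
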